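(* Let $[A,B]$ be a finite interval, let $q:[A,B]\to\mathbb{C}$ be continuous, and let $p,r:[A,B]\to\mathbb{R}$ be such that $p,p',r,r'$ are absolutely continuous on $[A,B]$ and $p(y)>0$, $r(y)>0$ for all $y\in[A,B]$. Put $\rho(y)=(p(y)r(y))^{1/4}$ and $l(y)=\int_A^y\{r(s)/p(s)\}^{1/2}ds$. Let $g$ be a (in general complex-valued) solution of $(p(y)g')'-q(y)g=0$ on $[A,B]$ with $g(A)=1/\rho(A)$ and $g(y)\ne0$ for all $y\in[A,B]$, and let $$h=\sqrt{\frac{p(A)}{r(A)}}\left(\frac{g'(A)}{g(A)}+\frac{\rho'(A)}{\rho(A)}\right).$$ For $\omega\in\mathbb{C}$, $\omega\neq0$, let $v_1(\omega,y)$ and $v_2(\omega,y)$ be the solutions of $$(p(y)v')'-q(y)v=-\omega^2r(y)v,\qquad y\in[A,B],$$ satisfying the initial conditions $$v_1(\omega,A)=\frac1{\rho(A)},\quad v_1'(\omega,A)=g'(A),\quad v_2(\omega,A)=0,\quad v_2'(\omega,A)=\frac{\omega}{\rho(A)}\sqrt{\frac{r(A)}{p(A)}}.$$ Then the derivatives of $v_1$ and $v_2$ with respect to $y$ admit the representations $$v_1'(\omega,y)=\sqrt{\frac{r(y)}{p(y)}}\left(\frac{1}{\rho(y)}\bigl(G_1(y)\cos(\omega l(y))-\omega\sin(\omega l(y))\bigr)+2\sum_{n=0}^\infty(-1)^n\mu_{2n}(y)j_{2n}(\omega l(y))\right)-\frac{\rho'(y)}{\rho(y)}v_1(\omega,y),$$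 $$v_2'(\omega,y)=\sqrt{\frac{r(y)}{p(y)}}\left(\frac{1}{\rho(y)}\bigl(G_2(y)\sin(\omega l(y))+\omega\cos(\omega l(y))\bigr)+2\sum_{n=0}^\infty(-1)^n\mu_{2n+1}(y)j_{2n+1}(\omega l(y))\right)-\frac{\rho'(y)}{\rho(y)}v_2(\omega,y),$$ where $$G_1(y)=h+\frac{\rho(y)\rho'(y)}{2r(y)}-\frac{\rho(A)\rho'(A)}{2r(A)}+\frac12\int_A^y\left[\frac{q(s)}{\rho^2(s)}+\frac{(\rho'(s))^2}{r(s)}\right]ds,\qquad G_2(y)=G_1(y)-h,$$ and, for $n=0,1,2,\ldots$, $$\mu_n(y)=\frac{2n+1}{2\rho(y)}\left(\sum_{k=0}^n\frac{l_{k,n}}{l^k(y)}\left(k\frac{\Psi_{k-1}(y)}{\rho(y)}+\rho(y)\sqrt{\frac{p(y)}{r(y)}}\left(\frac{g'(y)}{g(y)}+\frac{\rho'(y)}{\rho(y)}\right)\Phi_k(y)\right)-\frac{n(n+1)}{2l(y)}-G_2(y)-\frac h2\bigl(1+(-1)^n\bigr)\right),$$ with $\Phi_k,\Psi_k$ the formal powers defined in the context and $l_{k,n}$ the coefficient of $x^k$ in the Legendre polynomial of order $n$.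
   Context: Primes denote derivatives with respect to $y$. $j_k$ denotes the spherical Bessel function of order $k$. Formal powers. Set $Y^{(0)}\equiv\widetilde Y^{(0)}\equiv1$ and, for $n\ge1$, $$Y^{(n)}(y)=\begin{cases} n\int_A^y Y^{(n-1)}(s)\frac{1}{g^2(s)p(s)}ds,& n\text{ odd},\\ n\int_A^y Y^{(n-1)}(s)g^2(s)r(s)ds,& n\text{ even},\end{cases}$$ $$\widetilde Y^{(n)}(y)=\begin{cases} n\int_A^y\widetilde Y^{(n-1)}(s)g^2(s)r(s)ds,& n\text{ odd},\\ n\int_A^y\widetilde Y^{(n-1)}(s)\frac{1}{g^2(s)p(s)}ds,& n\text{ even}.\end{cases}$$ Then for $k=0,1,2,\ldots$ $$\Phi_k(y)=\begin{cases} g(y)Y^{(k)}(y),& k\text{ odd},\\ g(y)\widetilde Y^{(k)}(y),& k\text{ even},\end{cases}\qquad \Psi_k(y)=\begin{cases}\frac{1}{g(y)}Y^{(k)}(y),& k\text{ even},\\ \frac1{g(y)}\widetilde Y^{(k)}(y),& k\text{ odd}.\end{cases}$$ Conventions: in the sum defining $\mu_n$ the term $k\Psi_{k-1}$ is $0$ for $k=0$; at $y=A$, where $l(A)=0$, the value $\mu_n(A)$ is understood as the limit of $\mu_n(y)$ as $y\to A$. *)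

theory Defs
  imports "HOL-Analysis.Analysis" "HOL-Computational_Algebra.Polynomial"
begin

text \<open>The derivative on the closed interval \<open>[A,B]\<close>, one-sided at the end points.\<close>

abbreviation deriv_Icc ::
    "real \<Rightarrow> real \<Rightarrow> (real \<Rightarrow> 'a::real_normed_vector) \<Rightarrow> real \<Rightarrow> 'a" where
  "deriv_Icc A B f y \<equiv> vector_derivative f (at y within {A..B})"

definition abs_continuous_Icc :: "real \<Rightarrow> real \<Rightarrow> (real \<Rightarrow> real) \<Rightarrow> bool" where
  "abs_continuous_Icc A B f \<longleftrightarrow>
     (\<forall>\<epsilon>>0. \<exists>\<delta>>0. \<forall>I :: (real \<times> real) set.
        finite I \<and> (\<forall>(a, b)\<in>I. A \<le> a \<and> a < b \<and> b \<le> B) \<and>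
        pairwise (\<lambda>i j. {fst i<..<snd i} \<inter> {fst j<..<snd j} = {}) I \<and>
        (\<Sum>(a, b)\<in>I. b - a) < \<delta> \<longrightarrow>
        (\<Sum>(a, b)\<in>I. \<bar>f b - f a\<bar>) < \<epsilon>)"

text \<open>Classical solutions of \<open>(p u')' - q u = - c r u\<close> on \<open>[A,B]\<close>.\<close>

definition sl_solution ::
    "real \<Rightarrow> real \<Rightarrow> (real \<Rightarrow> real) \<Rightarrow> (real \<Rightarrow> complex) \<Rightarrow> (real \<Rightarrow> real) \<Rightarrow>
     complex \<Rightarrow> (real \<Rightarrow> complex) \<Rightarrow> bool" where
  "sl_solution A B p q r c u \<longleftrightarrow>
     u differentiable_on {A..B} \<and>
     (\<lambda>s. of_real (p s) * deriv_Icc A B u s) differentiable_on {A..B} \<and>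
     (\<forall>y\<in>{A..B}. deriv_Icc A B (\<lambda>s. of_real (p s) * deriv_Icc A B u s) y - q y * u y
                  = - c * of_real (r y) * u y)"

text \<open>
  The spherical Bessel function \<open>j\<^sub>k(z) = (\<pi> / (2 z))\<^sup>1\<^sup>/\<^sup>2 J\<^sub>k\<^sub>+\<^sub>1\<^sub>/\<^sub>2(z)\<close>, with the power series of
  \<open>J\<^sub>k\<^sub>+\<^sub>1\<^sub>/\<^sub>2\<close> inserted: the half-integer powers of \<open>z\<close> cancel, so that \<open>j\<^sub>k\<close> is entire and
  no branch has to be chosen.
\<close>

definition sph_bessel_j :: "nat \<Rightarrow> complex \<Rightarrow> complex" where
  "sph_bessel_j k z = of_real (sqrt pi) / 2 *
     (\<Sum>m. (-1) ^ m / (fact m * Gamma (of_nat (m + k) + 3 / 2)) * (z / 2) ^ (2 * m + k))"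

text \<open>Legendre polynomials by Rodrigues' formula.\<close>

definition legendre_poly :: "nat \<Rightarrow> real poly" where
  "legendre_poly n = smult (1 / (2 ^ n * fact n)) ((pderiv ^^ n) ([:- 1, 0, 1:] ^ n))"

text \<open>The formal powers \<open>Y\<^sup>(\<^sup>n\<^sup>)\<close> (\<open>formal_Y\<close>) and their tilde variants (\<open>formal_Yt\<close>).\<close>

fun formal_Y ::
    "real \<Rightarrow> (real \<Rightarrow> real) \<Rightarrow> (real \<Rightarrow> real) \<Rightarrow> (real \<Rightarrow> complex) \<Rightarrow> nat \<Rightarrow> real \<Rightarrow> complex" where
  "formal_Y A p r g 0 y = 1"
| "formal_Y A p r g (Suc n) y = of_nat (Suc n) *
     (if odd (Suc n)
      then integral {A..y} (\<lambda>s. formal_Y A p r g n s * (1 / ((g s)\<^sup>2 * of_real (p s))))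
      else integral {A..y} (\<lambda>s. formal_Y A p r g n s * ((g s)\<^sup>2 * of_real (r s))))"

fun formal_Yt ::
    "real \<Rightarrow> (real \<Rightarrow> real) \<Rightarrow> (real \<Rightarrow> real) \<Rightarrow> (real \<Rightarrow> complex) \<Rightarrow> nat \<Rightarrow> real \<Rightarrow> complex" where
  "formal_Yt A p r g 0 y = 1"
| "formal_Yt A p r g (Suc n) y = of_nat (Suc n) *
     (if odd (Suc n)
      then integral {A..y} (\<lambda>s. formal_Yt A p r g n s * ((g s)\<^sup>2 * of_real (r s)))
      else integral {A..y} (\<lambda>s. formal_Yt A p r g n s * (1 / ((g s)\<^sup>2 * of_real (p s)))))"

definition sl_Phi ::
    "real \<Rightarrow> (real \<Rightarrow> real) \<Rightarrow> (real \<Rightarrow> real) \<Rightarrow> (real \<Rightarrow> complex) \<Rightarrow> nat \<Rightarrow> real \<Rightarrow> complex" where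
  "sl_Phi A p r g k y =
     (if odd k then g y * formal_Y A p r g k y else g y * formal_Yt A p r g k y)"

definition sl_Psi ::
    "real \<Rightarrow> (real \<Rightarrow> real) \<Rightarrow> (real \<Rightarrow> real) \<Rightarrow> (real \<Rightarrow> complex) \<Rightarrow> nat \<Rightarrow> real \<Rightarrow> complex" where
  "sl_Psi A p r g k y =
     (if even k then 1 / g y * formal_Y A p r g k y else 1 / g y * formal_Yt A p r g k y)"

definition sl_rho :: "(real \<Rightarrow> real) \<Rightarrow> (real \<Rightarrow> real) \<Rightarrow> real \<Rightarrow> real" where
  "sl_rho p r y = (p y * r y) powr (1 / 4)"

definition sl_l :: "real \<Rightarrow> (real \<Rightarrow> real) \<Rightarrow> (real \<Rightarrow> real) \<Rightarrow> real \<Rightarrow> real" where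
  "sl_l A p r y = integral {A..y} (\<lambda>s. sqrt (r s / p s))"

definition sl_h ::
    "real \<Rightarrow> real \<Rightarrow> (real \<Rightarrow> real) \<Rightarrow> (real \<Rightarrow> real) \<Rightarrow> (real \<Rightarrow> complex) \<Rightarrow> complex" where
  "sl_h A B p r g = of_real (sqrt (p A / r A)) *
     (deriv_Icc A B g A / g A + of_real (deriv_Icc A B (sl_rho p r) A / sl_rho p r A))"

definition sl_G1 ::
    "real \<Rightarrow> real \<Rightarrow> (real \<Rightarrow> real) \<Rightarrow> (real \<Rightarrow> complex) \<Rightarrow> (real \<Rightarrow> real) \<Rightarrow> (real \<Rightarrow> complex) \<Rightarrow>
     real \<Rightarrow> complex" where
  "sl_G1 A B p q r g y = sl_h A B p r g
     + of_real (sl_rho p r y * deriv_Icc A B (sl_rho p r) y / (2 * r y))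
     - of_real (sl_rho p r A * deriv_Icc A B (sl_rho p r) A / (2 * r A))
     + 1 / 2 * integral {A..y} (\<lambda>s. q s / of_real ((sl_rho p r s)\<^sup>2)
                                  + of_real ((deriv_Icc A B (sl_rho p r) s)\<^sup>2 / r s))"

definition sl_G2 ::
    "real \<Rightarrow> real \<Rightarrow> (real \<Rightarrow> real) \<Rightarrow> (real \<Rightarrow> complex) \<Rightarrow> (real \<Rightarrow> real) \<Rightarrow> (real \<Rightarrow> complex) \<Rightarrow>
     real \<Rightarrow> complex" where
  "sl_G2 A B p q r g y = sl_G1 A B p q r g y - sl_h A B p r g"

text \<open>
  \<open>sl_mu_formula\<close> is meaningful for \<open>A < y\<close> only, since \<open>sl_l A p r A = 0\<close>; at \<open>y = A\<close> the
  function \<open>sl_mu\<close> takes its limit. In the summand \<open>k = 0\<close> the truncated index \<open>k - 1\<close> is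
  harmless because of the factor \<open>k\<close>.
\<close>

definition sl_mu_formula ::
    "real \<Rightarrow> real \<Rightarrow> (real \<Rightarrow> real) \<Rightarrow> (real \<Rightarrow> complex) \<Rightarrow> (real \<Rightarrow> real) \<Rightarrow> (real \<Rightarrow> complex) \<Rightarrow>
     nat \<Rightarrow> real \<Rightarrow> complex" where
  "sl_mu_formula A B p q r g n y =
     of_real ((2 * real n + 1) / (2 * sl_rho p r y)) *
     ((\<Sum>k\<le>n. of_real (coeff (legendre_poly n) k / sl_l A p r y ^ k) *
         (of_nat k * (sl_Psi A p r g (k - 1) y / of_real (sl_rho p r y))
          + of_real (sl_rho p r y * sqrt (p y / r y)) *
            (deriv_Icc A B g y / g y + of_real (deriv_Icc A B (sl_rho p r) y / sl_rho p r y)) *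
            sl_Phi A p r g k y))
      - of_real (real n * (real n + 1) / (2 * sl_l A p r y))
      - sl_G2 A B p q r g y
      - sl_h A B p r g / 2 * (1 + (-1) ^ n))"

definition sl_mu ::
    "real \<Rightarrow> real \<Rightarrow> (real \<Rightarrow> real) \<Rightarrow> (real \<Rightarrow> complex) \<Rightarrow> (real \<Rightarrow> real) \<Rightarrow> (real \<Rightarrow> complex) \<Rightarrow>
     nat \<Rightarrow> real \<Rightarrow> complex" where
  "sl_mu A B p q r g n y =
     (if y = A then Lim (at A within {A..B}) (sl_mu_formula A B p q r g n)
      else sl_mu_formula A B p q r g n y)"

end

theory Submission
  imports Defs
begin

text \<open>
  For \<open>y > A\<close> the functions \<open>G\<^sub>1\<close>, \<open>G\<^sub>2\<close> are immaterial: they cancel, and no transmutation kernel is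
  needed. Put \<open>x = l(y)\<close>. The expansion of \<open>t\<^sup>N / N!\<close> in Legendre polynomials gives, for every
  exponentially bounded sequence \<open>a\<close>, the Neumann series
  \<open>\<Sum>\<^sub>n (2n+1) i\<^sup>n j\<^sub>n(\<omega>x) \<Sum>\<^sub>k l\<^sub>k\<^sub>,\<^sub>n a\<^sub>k = \<Sum>\<^sub>k (i\<omega>x)\<^sup>k a\<^sub>k / k!\<close>. The terms \<open>G P\<^sub>n(1)\<close> and
  \<open>n(n+1)/(2x) = P\<^sub>n'(1)/x\<close> in \<open>\<mu>\<^sub>n\<close> correspond to \<open>a\<^sub>k = G\<close> and \<open>a\<^sub>k = k/x\<close>, so they reproduce
  the trigonometric terms of the representation. What remains is the
  power series of \<open>v' + (\<rho>'/\<rho>) v\<close> in \<open>\<omega>\<close>, whose coefficients are formal powers: \<open>v / g\<close> and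
  \<open>p (v' g - v g')\<close> solve a first order system, and its iterated integrals converge factorially.
  At \<open>y = A\<close> only \<open>\<mu>\<^sub>0(A) = 0\<close> matters, because \<open>j\<^sub>n(0) = 0\<close> for \<open>n \<ge> 1\<close>.
\<close>

section \<open>Legendre polynomials\<close>

text \<open>The functional \<open>t^k \<mapsto> a k\<close> need not come from a measure on [-1,1],
  so neither orthogonality nor the bound 1 for P_n on [-1,1] is available. Only the coefficients of
  P_n can be estimated, and the sum of their absolute values is bounded by 3^n. The order of
  summation can still be changed, because the coefficient of z^(n+2m) in j_n is at most 1/(n! m!).
  For the same reason the expansion of monomials is obtained algebraically, from Bonnet's
  recurrence, and not by integration.

  Parity organises the rest. P_n contains only powers of the parity of n, so v1 involves only even
  moments and v2 only odd ones. The two families of formal powers alternate between the same two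
  weights in opposite order, and the case distinctions in \<Phi> and \<Psi> are such that each
  solution meets a single family: the tilde powers for v1, the plain ones for v2. The term
  h(1+(-1)^n)/2 in mu_n belongs to the same pattern: it turns G2 into G1 for even n and vanishes for
  odd n.\<close>

lemma higher_pderiv_X_mult:
  fixes f :: "real poly"
  shows "(pderiv ^^ Suc n) ([:0, 1:] * f) =
    [:0, 1:] * (pderiv ^^ Suc n) f + smult (of_nat (Suc n)) ((pderiv ^^ n) f)"
proof (induction n)
  case 0
  show ?case by (simp add: pderiv_mult pderiv_pCons)
next
  case (Suc n)
  have "(pderiv ^^ Suc (Suc n)) ([:0, 1:] * f) = pderiv ((pderiv ^^ Suc n) ([:0, 1:] * f))"
    by simp
  also have "\<dots> = pderiv ([:0, 1:] * (pderiv ^^ Suc n) f + smult (of_nat (Suc n)) ((pderiv ^^ n) f))"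
    by (simp only: Suc.IH)
  also have "\<dots> = [:0, 1:] * (pderiv ^^ Suc (Suc n)) f + smult (of_nat (Suc (Suc n))) ((pderiv ^^ Suc n) f)"
  proof -
    have "pderiv [:0, 1:] = (1 :: real poly)" by (simp add: pderiv_pCons)
    then show ?thesis
      by (simp only: pderiv_add pderiv_mult pderiv_smult of_nat_Suc[of "Suc n"] smult_add_left smult_1_left
          mult_1_right funpow.simps o_apply add_ac)
  qed
  finally show ?case .
qed

abbreviation quad :: "real poly" where "quad \<equiv> [:- 1, 0, 1:]"

lemma pderiv_quad_power: "pderiv (quad ^ Suc n) = smult (2 * of_nat (Suc n)) ([:0, 1:] * quad ^ n)"
proof -
  have "pderiv quad = smult 2 [:0, 1:]" by (simp add: pderiv_pCons)
  then show ?thesis unfolding pderiv_power_Suc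
    by (simp only: mult_smult_left mult_smult_right smult_smult mult.commute)
qed

text \<open>Since X^2 = (X^2 - 1) + 1, the second derivative is again a combination of powers of
  \<open>quad\<close>, with no factor X left over.\<close>

lemma pderiv_pderiv_quad_power:
  "pderiv (pderiv (quad ^ Suc (Suc n))) =
     smult (2 * of_nat (Suc (Suc n)))
       (smult (2 * of_nat (Suc n) + 1) (quad ^ Suc n) + smult (2 * of_nat (Suc n)) (quad ^ n))"
proof -
  have X2: "[:0, 1:] * [:0, 1:] = quad + 1" by (simp add: one_pCons)
  have "pderiv ([:0, 1:] * quad ^ Suc n)
      = quad ^ Suc n + [:0, 1:] * pderiv (quad ^ Suc n)"
    unfolding pderiv_mult by (simp add: pderiv_pCons)
  also have "\<dots> = quad ^ Suc n + smult (2 * of_nat (Suc n)) (([:0, 1:] * [:0, 1:]) * quad ^ n)"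
    unfolding pderiv_quad_power by (simp only: mult_smult_right mult.assoc)
  also have "\<dots> = smult (2 * of_nat (Suc n) + 1) (quad ^ Suc n) + smult (2 * of_nat (Suc n)) (quad ^ n)"
    unfolding X2 by (simp only: ring_distribs mult_1_left power_Suc smult_add_left smult_add_right smult_1_left ac_simps)
  finally show ?thesis unfolding pderiv_quad_power[of "Suc n"] pderiv_smult by simp
qed

lemma legendre_poly_0: "legendre_poly 0 = 1"
  by (simp add: legendre_poly_def)

lemma legendre_poly_1: "legendre_poly (Suc 0) = [:0, 1:]"
  by (simp add: legendre_poly_def pderiv_pCons)

text \<open>Bonnet's recurrence. In Rodrigues' formula for P_(N+1), carrying out one derivative
  gives X P_N + N E, carrying out two gives (2N+1) E + P_(N-1), with the same polynomial E, an
  antiderivative of P_N. Eliminating E yields the claim.\<close>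

lemma legendre_poly_recurrence:
  "smult (real (Suc (Suc n))) (legendre_poly (Suc (Suc n))) =
     smult (2 * real n + 3) ([:0, 1:] * legendre_poly (Suc n)) - smult (real (Suc n)) (legendre_poly n)"
proof -
  define N where "N = Suc n"
  define c where "c = (\<lambda>n. 1 / (2 ^ n * fact n) :: real)"
  define E where "E = smult (c N) ((pderiv ^^ n) (quad ^ N))"
  have cS: "c (Suc m) * (2 * of_nat (Suc m)) = c m" for m
  proof -
    have "real (Suc m) \<noteq> 0" by simp
    then show ?thesis unfolding c_def fact_Suc power_Suc of_nat_mult of_nat_fact
      by (simp only: divide_simps) simp
  qed
  have P: "legendre_poly m = smult (c m) ((pderiv ^^ m) (quad ^ m))" for m
    by (simp add: legendre_poly_def c_def)
  have 1: "legendre_poly (Suc N) = [:0, 1:] * legendre_poly N + smult (of_nat N) E"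
  proof -
    have "(pderiv ^^ Suc N) (quad ^ Suc N) = (pderiv ^^ N) (pderiv (quad ^ Suc N))"
      by (simp only: funpow_Suc_right o_apply)
    also have "\<dots> = smult (2 * of_nat (Suc N)) ((pderiv ^^ N) ([:0, 1:] * quad ^ N))"
      by (simp only: pderiv_quad_power higher_pderiv_smult)
    also have "(pderiv ^^ N) ([:0, 1:] * quad ^ N) =
      [:0, 1:] * (pderiv ^^ N) (quad ^ N) + smult (of_nat N) ((pderiv ^^ n) (quad ^ N))"
      unfolding N_def by (rule higher_pderiv_X_mult)
    finally have "(pderiv ^^ Suc N) (quad ^ Suc N) = smult (2 * of_nat (Suc N))
      ([:0, 1:] * (pderiv ^^ N) (quad ^ N) + smult (of_nat N) ((pderiv ^^ n) (quad ^ N)))" .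
    then have "legendre_poly (Suc N) = smult (c N)
      ([:0, 1:] * (pderiv ^^ N) (quad ^ N) + smult (of_nat N) ((pderiv ^^ n) (quad ^ N)))"
      by (simp only: P smult_smult cS)
    then show ?thesis
      by (simp only: P E_def smult_add_right mult_smult_right smult_smult mult.commute)
  qed
  have 2: "legendre_poly (Suc N) = smult (2 * of_nat N + 1) E + legendre_poly n"
  proof -
    have "(pderiv ^^ Suc N) (quad ^ Suc N) = (pderiv ^^ n) (pderiv (pderiv (quad ^ Suc (Suc n))))"
      by (simp only: N_def funpow_Suc_right o_apply)
    also have "\<dots> = smult (2 * of_nat (Suc N))
      (smult (2 * of_nat N + 1) ((pderiv ^^ n) (quad ^ N)) + smult (2 * of_nat N) ((pderiv ^^ n) (quad ^ n)))"
      by (simp only: pderiv_pderiv_quad_power higher_pderiv_smult higher_pderiv_add N_def)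
    finally have *: "legendre_poly (Suc N) = smult (c N)
      (smult (2 * of_nat N + 1) ((pderiv ^^ n) (quad ^ N)) + smult (2 * of_nat N) ((pderiv ^^ n) (quad ^ n)))"
      by (simp only: P smult_smult cS)
    have "c N * (2 * of_nat N) = c n" unfolding N_def by (rule cS)
    then show ?thesis unfolding *
      by (simp only: P[of n] E_def smult_add_right smult_smult mult.commute)
  qed
  show ?thesis
  proof (rule poly_eqI)
    fix k
    have "coeff (legendre_poly (Suc N)) k = coeff ([:0, 1:] * legendre_poly N) k + real N * coeff E k"
      using 1 by simp
    moreover have "coeff (legendre_poly (Suc N)) k = (2 * real N + 1) * coeff E k + coeff (legendre_poly n) k"
      using 2 by simp
    ultimately have "(real N + 1) * coeff (legendre_poly (Suc N)) k =
        (2 * real N + 1) * coeff ([:0, 1:] * legendre_poly N) k - real N * coeff (legendre_poly n) k"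
      by algebra
    then show "coeff (smult (real (Suc (Suc n))) (legendre_poly (Suc (Suc n)))) k =
      coeff (smult (2 * real n + 3) ([:0, 1:] * legendre_poly (Suc n)) - smult (real (Suc n)) (legendre_poly n)) k"
      by (cases k) (simp_all add: N_def algebra_simps)
  qed
qed

text \<open>Bonnet's recurrence solved for X P_n. At n = 0 the truncated index \<open>n - 1\<close>
  is harmless because its factor is 0.\<close>

lemma X_mult_legendre_poly:
  "[:0, 1:] * smult (2 * real n + 1) (legendre_poly n) =
     smult (real n + 1) (legendre_poly (Suc n)) + smult (real n) (legendre_poly (n - 1))"
proof (cases n)
  case 0
  then show ?thesis by (simp add: legendre_poly_0 legendre_poly_1)
next
  case (Suc m)
  have "real (Suc m) + 1 = real (Suc (Suc m))" by simp
  then show ?thesis unfolding Suc using legendre_poly_recurrence[of m]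
    by (simp only: mult_smult_right diff_Suc_1) (simp add: algebra_simps)
qed

lemma coeff_legendre_recurrence:
  "real (Suc (Suc n)) * coeff (legendre_poly (Suc (Suc n))) k =
     (2 * real n + 3) * (case k of 0 \<Rightarrow> 0 | Suc j \<Rightarrow> coeff (legendre_poly (Suc n)) j)
     - real (Suc n) * coeff (legendre_poly n) k"
proof -
  have "coeff (smult (real (Suc (Suc n))) (legendre_poly (Suc (Suc n)))) k =
      coeff (smult (2 * real n + 3) ([:0, 1:] * legendre_poly (Suc n)) - smult (real (Suc n)) (legendre_poly n)) k"
    by (simp only: legendre_poly_recurrence)
  then show ?thesis by (cases k) simp_all
qed

lemma coeff_legendre_eq_0:
  assumes "n < k \<or> odd (n + k)"
  shows "coeff (legendre_poly n) k = 0"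
  using assms
proof (induction n arbitrary: k rule: induct_nat_012)
  case 0
  then show ?case by (cases k) (auto simp: legendre_poly_0 one_pCons)
next
  case 1
  then show ?case by (auto simp: legendre_poly_1 coeff_pCons split: nat.splits)
next
  case (ge2 n)
  have "real (Suc (Suc n)) * coeff (legendre_poly (Suc (Suc n))) k = 0"
    unfolding coeff_legendre_recurrence using ge2 by (auto split: nat.splits)
  then show ?case by simp
qed

section \<open>Values at 1 and growth of the coefficients\<close>

lemma poly_legendre_1: "poly (legendre_poly n) 1 = 1"
proof (induction n rule: induct_nat_012)
  case (ge2 n)
  have "poly (smult (real (Suc (Suc n))) (legendre_poly (Suc (Suc n)))) 1 = 2 * real n + 3 - real (Suc n)"
    unfolding legendre_poly_recurrence using ge2 by simp
  then have "real (Suc (Suc n)) * poly (legendre_poly (Suc (Suc n))) 1 = real (Suc (Suc n)) * 1"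
    by simp
  then show ?case by (simp only: mult_cancel_left) auto
qed (simp_all add: legendre_poly_0 legendre_poly_1)

lemma poly_pderiv_legendre_1: "poly (pderiv (legendre_poly n)) 1 = real n * (real n + 1) / 2"
proof (induction n rule: induct_nat_012)
  case (ge2 n)
  have "pderiv (smult (real (Suc (Suc n))) (legendre_poly (Suc (Suc n)))) =
    smult (2 * real n + 3) (legendre_poly (Suc n) + [:0, 1:] * pderiv (legendre_poly (Suc n)))
     - smult (real (Suc n)) (pderiv (legendre_poly n))"
    unfolding legendre_poly_recurrence pderiv_diff pderiv_smult pderiv_mult
    by (simp add: pderiv_pCons add.commute)
  then have "poly (pderiv (smult (real (Suc (Suc n))) (legendre_poly (Suc (Suc n))))) 1 =
     (2 * real n + 3) * (1 + real (Suc n) * (real (Suc n) + 1) / 2) - real (Suc n) * (real n * (real n + 1) / 2)"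
    by (simp only: ge2 poly_diff poly_smult poly_add poly_mult poly_legendre_1) simp
  then have "real (Suc (Suc n)) * poly (pderiv (legendre_poly (Suc (Suc n)))) 1 =
      real (Suc (Suc n)) * (real (Suc (Suc n)) * (real (Suc (Suc n)) + 1) / 2)"
    by (simp add: pderiv_smult field_simps)
  then show ?case by (simp only: mult_cancel_left) auto
qed (simp_all add: legendre_poly_0 legendre_poly_1 pderiv_pCons)

lemma degree_legendre_le: "degree (legendre_poly n) \<le> n"
  by (rule degree_le) (simp add: coeff_legendre_eq_0)

lemma poly_1_eq_sum_coeff:
  fixes P :: "real poly"
  assumes "degree P \<le> n"
  shows "poly P 1 = (\<Sum>k\<le>n. coeff P k)"
proof -
  have "poly P 1 = poly (\<Sum>k\<le>n. monom (coeff P k) k) 1"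
    by (simp only: poly_as_sum_of_monoms'[OF assms])
  then show ?thesis by (simp add: poly_sum poly_monom)
qed

lemma sum_coeff_legendre: "(\<Sum>k\<le>n. coeff (legendre_poly n) k) = 1"
proof -
  have "poly (legendre_poly n) 1 = (\<Sum>k\<le>n. coeff (legendre_poly n) k)"
    by (rule poly_1_eq_sum_coeff) (rule degree_legendre_le)
  then show ?thesis by (simp add: poly_legendre_1)
qed

lemma sum_coeff_legendre_deriv:
  "(\<Sum>k\<le>n. coeff (legendre_poly n) k * real k) = real n * (real n + 1) / 2"
proof -
  have "poly (pderiv (legendre_poly n)) 1 = (\<Sum>k\<le>n. coeff (pderiv (legendre_poly n)) k)"
    by (rule poly_1_eq_sum_coeff) (metis degree_legendre_le degree_pderiv diff_le_self le_trans)
  also have "\<dots> = (\<Sum>k\<le>n. coeff (legendre_poly n) (Suc k) * real (Suc k))"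
    by (simp add: coeff_pderiv mult.commute)
  also have "\<dots> = (\<Sum>k\<le>Suc n. coeff (legendre_poly n) k * real k)"
    by (subst sum.atMost_Suc_shift) simp
  also have "\<dots> = (\<Sum>k\<le>n. coeff (legendre_poly n) k * real k)"
    by (simp add: coeff_legendre_eq_0)
  finally show ?thesis by (simp add: poly_pderiv_legendre_1)
qed

text \<open>Bonnet's recurrence without its signs gives S_(n+2) \<le> 2 M S_(n+1) + S_n for these
  sums. The base 3M works because 6 M^2 + 1 \<le> 9 M^2 for M \<ge> 1.\<close>

lemma sum_abs_coeff_legendre_le:
  assumes "M \<ge> 1"
  shows "(\<Sum>k\<le>n. \<bar>coeff (legendre_poly n) k\<bar> * M ^ k) \<le> (3 * M) ^ n"
proof (induction n rule: induct_nat_012)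
  case 0
  then show ?case by (simp add: legendre_poly_0)
next
  case 1
  then show ?case using assms by (simp add: legendre_poly_1)
next
  case (ge2 n)
  let ?S = "\<lambda>n. (\<Sum>k\<le>n. \<bar>coeff (legendre_poly n) k\<bar> * M ^ k)"
  let ?c = "\<lambda>n k. coeff (legendre_poly n) k"
  have "real (Suc (Suc n)) * ?S (Suc (Suc n)) = (\<Sum>k\<le>Suc (Suc n). \<bar>real (Suc (Suc n)) * ?c (Suc (Suc n)) k\<bar> * M ^ k)"
    by (simp only: sum_distrib_left abs_mult abs_of_nat mult.assoc)
  also have "\<dots> \<le> (\<Sum>k\<le>Suc (Suc n). ((2 * real n + 3) * (case k of 0 \<Rightarrow> 0 | Suc j \<Rightarrow> \<bar>?c (Suc n) j\<bar>) + real (Suc n) * \<bar>?c n k\<bar>) * M ^ k)"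
    unfolding coeff_legendre_recurrence
    by (intro sum_mono mult_right_mono order_trans[OF abs_triangle_ineq4])
       (use assms in \<open>auto split: nat.splits simp: abs_mult\<close>)
  also have "\<dots> = (2 * real n + 3) * (\<Sum>k\<le>Suc (Suc n). (case k of 0 \<Rightarrow> 0 | Suc j \<Rightarrow> \<bar>?c (Suc n) j\<bar>) * M ^ k)
      + real (Suc n) * (\<Sum>k\<le>Suc (Suc n). \<bar>?c n k\<bar> * M ^ k)"
    by (simp only: distrib_right sum.distrib sum_distrib_left mult.assoc)
  also have "(\<Sum>k\<le>Suc (Suc n). (case k of 0 \<Rightarrow> 0 | Suc j \<Rightarrow> \<bar>?c (Suc n) j\<bar>) * M ^ k) = M * ?S (Suc n)"
    by (subst sum.atMost_Suc_shift) (simp add: sum_distrib_left algebra_simps)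
  also have "(\<Sum>k\<le>Suc (Suc n). \<bar>?c n k\<bar> * M ^ k) = ?S n"
    by (simp add: coeff_legendre_eq_0)
  \<comment> \<open>Both factors are enlarged, to 2(n+2) and n+2, so that n+2 can be divided out at
    the end.\<close>
  also have "(2 * real n + 3) * (M * ?S (Suc n)) + real (Suc n) * ?S n
      \<le> (2 * real n + 4) * (M * (3 * M) ^ Suc n) + real (Suc (Suc n)) * (3 * M) ^ n"
    by (intro add_mono mult_mono ge2.IH) (use assms in \<open>auto intro!: add_nonneg_nonneg mult_nonneg_nonneg sum_nonneg\<close>)
  also have "\<dots> = real (Suc (Suc n)) * ((6 * M\<^sup>2 + 1) * (3 * M) ^ n)"
    by (simp add: algebra_simps power2_eq_square)
  also have "\<dots> \<le> real (Suc (Suc n)) * ((9 * M\<^sup>2) * (3 * M) ^ n)"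
  proof -
    have "1 \<le> M\<^sup>2" using assms by (rule one_le_power)
    then have "6 * M\<^sup>2 + 1 \<le> 9 * M\<^sup>2" by linarith
    then show ?thesis using assms by (intro mult_left_mono mult_right_mono) auto
  qed
  also have "9 * M\<^sup>2 * (3 * M) ^ n = (3 * M) ^ Suc (Suc n)"
    by (simp add: power2_eq_square)
  finally show ?case by (simp add: mult_le_cancel_left del: of_nat_Suc power_Suc sum.atMost_Suc)
qed

section \<open>Neumann series of spherical Bessel functions\<close>

text \<open>\<open>j\<^sub>n(z) = \<Sum>\<^sub>m (-1)\<^sup>m bessel_coeff m n z\<^sup>2\<^sup>m\<^sup>+\<^sup>n\<close>, with the Gamma factor evaluated.\<close>

definition bessel_coeff :: "nat \<Rightarrow> nat \<Rightarrow> real" where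
  "bessel_coeff m n = 2 ^ n * fact (n + m) / (fact m * fact (2 * n + 2 * m + 1))"

lemma Gamma_nat_plus_three_halves:
  "Gamma (of_nat N + 3 / 2 :: complex) =
     of_real (sqrt pi) / 2 * (fact (2 * N + 1) / (4 ^ N * fact N))"
proof (induction N)
  case 0
  have "Gamma (1 / 2 + 1 :: complex) = 1 / 2 * Gamma (1 / 2)"
    by (rule Gamma_plus1) (auto elim!: nonpos_Ints_cases' simp: complex_eq_iff)
  then show ?case by (simp add: Gamma_one_half_complex)
next
  case (Suc N)
  have nz: "of_nat N + 3 / 2 \<notin> (\<int>\<^sub>\<le>\<^sub>0 :: complex set)"
  proof
    assume "of_nat N + 3 / 2 \<in> (\<int>\<^sub>\<le>\<^sub>0 :: complex set)"
    then obtain m where "of_nat N + 3 / 2 = (- of_nat m :: complex)"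
      by (elim nonpos_Ints_cases')
    then have "real N + 3 / 2 = - real m" by (simp add: complex_eq_iff)
    then show False by linarith
  qed
  have "Gamma (of_nat (Suc N) + 3 / 2 :: complex) = Gamma ((of_nat N + 3 / 2) + 1)"
    by (simp add: algebra_simps)
  also have "\<dots> = (of_nat N + 3 / 2) * (of_real (sqrt pi) / 2 * (fact (2 * N + 1) / (4 ^ N * fact N)))"
    by (simp only: Gamma_plus1[OF nz] Suc.IH)
  also have "\<dots> = of_real (sqrt pi) / 2 * (fact (2 * Suc N + 1) / (4 ^ Suc N * fact (Suc N)))"
  proof -
    have cancel: "x * (c * (F / (P * G))) = c * (4 * x * k * F / (4 * P * (k * G)))"
      if "k \<noteq> 0" for x c F P G k :: complex
      using that by simp
    have "2 * Suc N + 1 = Suc (Suc (2 * N + 1))" by simp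
    then have "fact (2 * Suc N + 1) = (of_nat (Suc (Suc (2 * N + 1))) * (of_nat (Suc (2 * N + 1)) * fact (2 * N + 1)) :: complex)"
      by (simp only: fact_Suc)
    also have "\<dots> = 4 * (of_nat N + 3 / 2) * of_nat (Suc N) * fact (2 * N + 1)"
      by (simp add: algebra_simps del: fact_Suc)
    finally show ?thesis
      unfolding fact_Suc[of N] power_Suc by (simp only: cancel[OF of_nat_neq_0])
  qed
  finally show ?case .
qed

text \<open>The central binomial coefficient is at least 2^N: from N to N+1 it is multiplied by
  2(2N+1)/(N+1) \<ge> 2.\<close>

lemma two_power_fact_le: "2 ^ N * fact N * fact N \<le> (fact (2 * N) :: real)"
proof (induction N)
  case (Suc N)
  have "2 ^ Suc N * fact (Suc N) * fact (Suc N) = (2 * (real N + 1)\<^sup>2) * (2 ^ N * fact N * fact N :: real)"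
    by (simp add: power2_eq_square algebra_simps)
  also have "\<dots> \<le> ((2 * real N + 2) * (2 * real N + 1)) * fact (2 * N)"
  proof -
    have "2 * (real N + 1)\<^sup>2 \<le> (2 * real N + 2) * (2 * real N + 1)"
      by (simp add: power2_eq_square algebra_simps)
    then show ?thesis by (rule mult_mono[OF _ Suc.IH]) auto
  qed
  also have "\<dots> = fact (2 * Suc N)" by (simp add: algebra_simps)
  finally show ?case .
qed simp

lemma bessel_coeff_nonneg: "0 \<le> bessel_coeff m n"
  by (simp add: bessel_coeff_def)

text \<open>Factorial decay in each index separately makes the double series below comparable with a
  product of two exponential series. The weight 2n+1 of the Neumann series is absorbed by the last
  factor of the odd factorial in the denominator.\<close>

lemma bessel_coeff_le: "(2 * real n + 1) * bessel_coeff m n \<le> 1 / (fact m * fact n)"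
proof -
  let ?N = "n + m"
  have "(2 * real n + 1) * (2 ^ n * fact ?N * fact n) \<le> (2 * real ?N + 1) * (2 ^ ?N * fact ?N * fact ?N)"
    by (intro mult_mono power_increasing fact_mono) auto
  also have "\<dots> \<le> (2 * real ?N + 1) * fact (2 * ?N)"
    by (intro mult_left_mono two_power_fact_le) auto
  also have "\<dots> = fact (2 * n + 2 * m + 1)" by (simp add: algebra_simps)
  finally have *: "(2 * real n + 1) * (2 ^ n * fact ?N * fact n) \<le> fact (2 * n + 2 * m + 1)" .
  have scale: "X * (P / (a * F)) \<le> 1 / (a * b)" if "X * (P * b) \<le> F" "a > 0" "b > 0" "F > 0"
    for X P a b F :: real
    using that by (simp add: field_simps)
  show ?thesis unfolding bessel_coeff_def by (rule scale[OF *]) simp_all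
qed

lemma bessel_coeff_le_fact: "bessel_coeff m n \<le> 1 / fact m"
proof -
  have "1 * bessel_coeff m n \<le> (2 * real n + 1) * bessel_coeff m n"
    by (intro mult_right_mono bessel_coeff_nonneg) auto
  also have "\<dots> \<le> 1 / (fact m * fact n)" by (rule bessel_coeff_le)
  also have "\<dots> \<le> 1 / fact m" by (intro divide_left_mono) (auto simp: fact_ge_1)
  finally show ?thesis by simp
qed

lemma sph_bessel_j_sums:
  "(\<lambda>m. (-1) ^ m * of_real (bessel_coeff m n) * z ^ (2 * m + n)) sums sph_bessel_j n z"
proof -
  have nz: "complex_of_real (sqrt pi) \<noteq> 0" by simp
  have cancel: "c / (a * (c * (F / (R * Q * G))) * R) = Q * G / (a * F)"
    if "c \<noteq> 0" "R \<noteq> 0" for c a F R Q G :: complex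
    using that by (simp add: field_simps)
  have term_eq: "of_real (sqrt pi) / 2 * ((-1) ^ m / (fact m * Gamma (of_nat (m + n) + 3 / 2)) * (z / 2) ^ (2 * m + n))
      = (-1) ^ m * of_real (bessel_coeff m n) * z ^ (2 * m + n)" for m
  proof -
    \<comment> \<open>The power of 4 from the Gamma factor splits: one part cancels the denominator
      of (z/2)^(2m+n), the other is the 2^n in \<open>bessel_coeff\<close>.\<close>
    have "(4::complex) ^ (m + n) = 2 ^ (2 * m + n) * 2 ^ n"
      by (simp add: power_add power_mult flip: power_mult_distrib)
    then have "of_real (sqrt pi) / 2 * (1 / (fact m * Gamma (of_nat (m + n) + 3 / 2)) / 2 ^ (2 * m + n))
        = complex_of_real (bessel_coeff m n)"
      unfolding Gamma_nat_plus_three_halves bessel_coeff_def using nz cancel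
      by (simp add: add.commute[of m n] distrib_left del: fact_Suc)
    moreover have "c * (e / X * (z / 2) ^ d) = e * (c * (1 / X / 2 ^ d)) * z ^ d" for c e X :: complex and d
      by (simp add: power_divide)
    ultimately show ?thesis by (simp only:)
  qed
  have summ: "summable (\<lambda>m. (-1) ^ m * complex_of_real (bessel_coeff m n) * z ^ (2 * m + n))"
  proof (rule summable_comparison_test')
    show "summable (\<lambda>m. (1 / fact m * (norm z ^ 2) ^ m) * norm z ^ n)"
      using summable_exp_generic[of "norm z ^ 2"] by (intro summable_mult2) (simp add: divide_inverse)
    show "norm ((-1) ^ m * complex_of_real (bessel_coeff m n) * z ^ (2 * m + n)) \<le> (1 / fact m * (norm z ^ 2) ^ m) * norm z ^ n" for m
    proof -
      have "norm ((-1) ^ m * complex_of_real (bessel_coeff m n) * z ^ (2 * m + n))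
         = bessel_coeff m n * ((norm z ^ 2) ^ m * norm z ^ n)"
        by (simp add: norm_mult norm_power power_add power_mult bessel_coeff_nonneg)
      also have "\<dots> \<le> 1 / fact m * ((norm z ^ 2) ^ m * norm z ^ n)"
        by (intro mult_right_mono bessel_coeff_le_fact) auto
      finally show ?thesis by (simp only: mult.assoc)
    qed
  qed
  then have "summable (\<lambda>m. of_real (sqrt pi) / 2 * ((-1) ^ m / (fact m * Gamma (of_nat (m + n) + 3 / 2)) * (z / 2) ^ (2 * m + n)))"
    by (simp only: term_eq)
  then have "summable (\<lambda>m. (-1) ^ m / (fact m * Gamma (of_nat (m + n) + 3 / 2)) * (z / 2) ^ (2 * m + n))"
    by (subst (asm) summable_cmult_iff) (use nz in auto)
  then have "sph_bessel_j n z = (\<Sum>m. (-1) ^ m * of_real (bessel_coeff m n) * z ^ (2 * m + n))"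
    unfolding sph_bessel_j_def by (simp only: suminf_mult[symmetric] term_eq)
  with summ show ?thesis by (simp add: summable_sums)
qed

lemma bessel_coeff_diff_first:
  "bessel_coeff m n = (2 * real n + 2 * real m + 3) * bessel_coeff m (Suc n)"
proof -
  have "fact (2 * Suc n + 2 * m + 1) = (2 * real n + 2 * real m + 3) * (2 * real (Suc (n + m)) * fact (2 * n + 2 * m + 1))"
    by (simp add: algebra_simps)
  then show ?thesis unfolding bessel_coeff_def
    by (simp add: divide_simps del: of_nat_Suc) 
qed

lemma bessel_coeff_shift: "bessel_coeff m (Suc n) = 2 * real (Suc m) * bessel_coeff (Suc m) n"
  unfolding bessel_coeff_def by (simp add: divide_simps del: of_nat_Suc)

section \<open>Legendre expansion of monomials\<close>

text \<open>The coefficient of \<open>(2 n + 1) P\<^sub>n\<close> in the Legendre expansion of \<open>t\<^sup>N / N!\<close>.\<close>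

definition legendre_monom_coeff :: "nat \<Rightarrow> nat \<Rightarrow> real" where
  "legendre_monom_coeff N n =
     (if n \<le> N \<and> even (N - n) then bessel_coeff ((N - n) div 2) n else 0)"

text \<open>The coefficient form of (2n+1) j_n' = n j_(n-1) - (n+1) j_(n+1), since the numbers
  \<open>legendre_monom_coeff N n\<close> are the coefficients of (i z)^N in i^n j_n(z).\<close>

lemma legendre_monom_coeff_recurrence:
  "(real N + 1) * ((2 * real n + 1) * legendre_monom_coeff (Suc N) n) =
     real n * legendre_monom_coeff N (n - 1) + (real n + 1) * legendre_monom_coeff N (Suc n)"
proof (cases "n \<le> Suc N \<and> even (Suc N - n)")
  case True
  then obtain m where m: "Suc N = n + 2 * m" by (metis dvdE le_add_diff_inverse)
  have 1: "legendre_monom_coeff (Suc N) n = bessel_coeff m n"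
    unfolding legendre_monom_coeff_def m by simp
  have 2: "real n * legendre_monom_coeff N (n - 1) = real n * ((2 * real n + 2 * real m + 1) * bessel_coeff m n)"
  proof (cases n)
    case (Suc k)
    then have "N = k + 2 * m" using m by simp
    then show ?thesis unfolding Suc legendre_monom_coeff_def
      using bessel_coeff_diff_first[of m k] by (simp add: algebra_simps)
  qed simp
  have 3: "legendre_monom_coeff N (Suc n) = 2 * real m * bessel_coeff m n"
  proof (cases m)
    \<comment> \<open>Here n = N + 1, so the index \<open>Suc n\<close> exceeds N and the
      coefficient is 0 by definition.\<close>
    case 0
    then show ?thesis using m by (simp add: legendre_monom_coeff_def)
  next
    case (Suc k)
    then have N: "N = Suc n + 2 * k" using m by simp
    show ?thesis unfolding N legendre_monom_coeff_def Suc
      using bessel_coeff_shift[of k n] by simp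
  qed
  have N: "real N + 1 = real n + 2 * real m" using m by linarith
  show ?thesis unfolding 1 2 3 N by (simp add: algebra_simps)
next
  case False
  have "real n * legendre_monom_coeff N (n - 1) = 0"
    using False by (cases n) (auto simp: legendre_monom_coeff_def)
  moreover have "legendre_monom_coeff N (Suc n) = 0"
    using False by (auto simp: legendre_monom_coeff_def Suc_diff_le)
  moreover have "legendre_monom_coeff (Suc N) n = 0"
    using False by (auto simp: legendre_monom_coeff_def)
  ultimately show ?thesis by (simp only: mult_zero_right add_0)
qed

text \<open>The part of degree N of the plane wave expansion exp(i z t) = \<Sum> (2n+1) i^n j_n(z)
  P_n(t). The induction multiplies by X, applies Bonnet's recurrence to each X P_n and compares
  coefficients.\<close>

lemma monom_legendre_expansion:
  "monom (1 / fact N) N =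
     (\<Sum>n\<le>N. smult ((2 * real n + 1) * legendre_monom_coeff N n) (legendre_poly n))"
proof (induction N)
  case 0
  show ?case by (simp add: legendre_monom_coeff_def bessel_coeff_def legendre_poly_0 monom_0)
next
  case (Suc N)
  let ?\<delta> = legendre_monom_coeff
  have "smult (real N + 1) (monom (1 / fact (Suc N)) (Suc N)) = [:0, 1:] * monom (1 / fact N) N"
    by (simp add: monom_Suc smult_monom add.commute del: of_nat_Suc flip: of_nat_Suc)
  also have "\<dots> = (\<Sum>n\<le>N. smult (?\<delta> N n) ([:0, 1:] * smult (2 * real n + 1) (legendre_poly n)))"
    unfolding Suc sum_distrib_left by (simp only: mult_smult_right smult_smult mult.commute)
  also have "\<dots> = (\<Sum>n\<le>N. smult (?\<delta> N n) (smult (real n + 1) (legendre_poly (Suc n))))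
      + (\<Sum>n\<le>N. smult (?\<delta> N n) (smult (real n) (legendre_poly (n - 1))))"
    by (simp only: X_mult_legendre_poly smult_add_right sum.distrib)
  also have "(\<Sum>n\<le>N. smult (?\<delta> N n) (smult (real n + 1) (legendre_poly (Suc n))))
      = (\<Sum>n\<le>Suc N. smult (real n * ?\<delta> N (n - 1)) (legendre_poly n))"
    by (simp add: sum.atMost_Suc_shift mult.commute add.commute del: sum.atMost_Suc)
  \<comment> \<open>Two vanishing terms with n > N are appended; dropping the vanishing term n = 0
    and shifting then gives the range of the other sum.\<close>
  also have "(\<Sum>n\<le>N. smult (?\<delta> N n) (smult (real n) (legendre_poly (n - 1))))
      = (\<Sum>n\<le>Suc (Suc N). smult (?\<delta> N n) (smult (real n) (legendre_poly (n - 1))))"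
    by (simp add: legendre_monom_coeff_def)
  also have "\<dots> = (\<Sum>n\<le>Suc N. smult ((real n + 1) * ?\<delta> N (Suc n)) (legendre_poly n))"
    by (subst sum.atMost_Suc_shift) (simp add: mult.commute add.commute)
  also have "(\<Sum>n\<le>Suc N. smult (real n * ?\<delta> N (n - 1)) (legendre_poly n)) + \<dots>
      = (\<Sum>n\<le>Suc N. smult ((real N + 1) * ((2 * real n + 1) * ?\<delta> (Suc N) n)) (legendre_poly n))"
    by (simp only: sum.distrib[symmetric] smult_add_left[symmetric] legendre_monom_coeff_recurrence)
  also have "\<dots> = smult (real N + 1) (\<Sum>n\<le>Suc N. smult ((2 * real n + 1) * ?\<delta> (Suc N) n) (legendre_poly n))"
    by (rule poly_eqI) (simp only: coeff_sum coeff_smult sum_distrib_left mult.assoc)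
  finally have "smult (real N + 1) (monom (1 / fact (Suc N)) (Suc N)) =
     smult (real N + 1) (\<Sum>n\<le>Suc N. smult ((2 * real n + 1) * ?\<delta> (Suc N) n) (legendre_poly n))" .
  moreover have "real N + 1 \<noteq> 0" by simp
  ultimately show ?case by (simp only: smult_cancel)
qed

text \<open>The value of the linear functional \<open>t\<^sup>k \<mapsto> a k\<close> at \<open>P\<^sub>n\<close>.\<close>

definition legendre_apply :: "(nat \<Rightarrow> complex) \<Rightarrow> nat \<Rightarrow> complex" where
  "legendre_apply a n = (\<Sum>k\<le>n. of_real (coeff (legendre_poly n) k) * a k)"

text \<open>The functional applied to both sides of \<open>monom_legendre_expansion\<close>.\<close>

lemma sum_legendre_apply:
  "(\<Sum>n\<le>N. of_real ((2 * real n + 1) * legendre_monom_coeff N n) * legendre_apply a n) = a N / fact N"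
proof -
  have ext: "legendre_apply a n = (\<Sum>k\<le>N. of_real (coeff (legendre_poly n) k) * a k)" if "n \<le> N" for n
    unfolding legendre_apply_def
    by (rule sum.mono_neutral_left) (use that in \<open>auto simp: coeff_legendre_eq_0\<close>)
  have "(\<Sum>n\<le>N. of_real ((2 * real n + 1) * legendre_monom_coeff N n) * legendre_apply a n)
      = (\<Sum>n\<le>N. \<Sum>k\<le>N. of_real ((2 * real n + 1) * legendre_monom_coeff N n * coeff (legendre_poly n) k) * a k)"
    by (intro sum.cong refl) (simp add: ext sum_distrib_left mult.assoc)
  also have "\<dots> = (\<Sum>k\<le>N. of_real (\<Sum>n\<le>N. (2 * real n + 1) * legendre_monom_coeff N n * coeff (legendre_poly n) k) * a k)"
    by (subst sum.swap) (simp add: sum_distrib_right)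
  also have "\<dots> = (\<Sum>k\<le>N. of_real (coeff (monom (1 / fact N) N) k) * a k)"
    unfolding monom_legendre_expansion by (simp add: coeff_sum)
  also have "\<dots> = (\<Sum>k\<le>N. if k = N then a k / fact N else 0)"
    by (intro sum.cong refl) auto
  also have "\<dots> = a N / fact N" by simp
  finally show ?thesis .
qed

lemma norm_legendre_apply_le:
  assumes a: "\<And>k. norm (a k) \<le> C * M ^ k" and M: "M \<ge> 1"
  shows "norm (legendre_apply a n) \<le> C * (3 * M) ^ n"
proof -
  \<comment> \<open>The bound at k = 0 already forces C to be nonnegative.\<close>
  have "norm (a 0) \<le> C * M ^ 0" by (rule a)
  then have C: "0 \<le> C" using norm_ge_zero[of "a 0"] by (simp del: norm_ge_zero)
  have "norm (legendre_apply a n) \<le> (\<Sum>k\<le>n. \<bar>coeff (legendre_poly n) k\<bar> * (C * M ^ k))"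
    unfolding legendre_apply_def by (intro sum_norm_le) (auto simp: norm_mult intro!: mult_left_mono a)
  also have "\<dots> = C * (\<Sum>k\<le>n. \<bar>coeff (legendre_poly n) k\<bar> * M ^ k)"
    by (simp add: sum_distrib_left ac_simps)
  also have "\<dots> \<le> C * (3 * M) ^ n"
    by (intro mult_left_mono sum_abs_coeff_legendre_le C M)
  finally show ?thesis .
qed

text \<open>The plane wave expansion with t^k replaced by \<open>a k\<close>. Inserting the power
  series of j_n gives a double series T(n, m), dominated by C (3MR)^n/n! (R^2)^m/m! with R = |z|.
  Summed over m first it is the Neumann series; summed along n + 2m = N first it is the power
  series, by \<open>sum_legendre_apply\<close>.\<close>

theorem neumann_series_legendre:
  assumes a: "\<And>k. norm (a k) \<le> C * M ^ k" and M: "M \<ge> 1"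
    and S: "(\<lambda>k. (\<i> * z) ^ k / fact k * a k) sums S"
  shows "(\<lambda>n. (2 * of_nat n + 1) * \<i> ^ n * sph_bessel_j n z * legendre_apply a n) sums S"
proof -
  let ?b = "legendre_apply a"
  have "norm (a 0) \<le> C * M ^ 0" by (rule a)
  then have C: "0 \<le> C" using norm_ge_zero[of "a 0"] by (simp del: norm_ge_zero)
  define T where "T = (\<lambda>(n, m). (2 * of_nat n + 1) * \<i> ^ n * ?b n *
     ((-1) ^ m * complex_of_real (bessel_coeff m n) * z ^ (2 * m + n)))"
  define R where "R = norm z"
  have exp_abs: "(\<lambda>n. norm (x ^ n / fact n)) summable_on UNIV" for x :: real
  proof -
    have "summable (\<lambda>n. norm (x ^ n / fact n))"
      using summable_norm_exp[of x] by (simp only: divide_inverse_commute real_scaleR_def)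
    then show ?thesis by (simp add: summable_on_UNIV_nonneg_real_iff)
  qed
  have dom: "(\<lambda>x. norm (case x of (n, m) \<Rightarrow> ((3 * M * R) ^ n / fact n) * ((R\<^sup>2) ^ m / fact m))) summable_on UNIV \<times> UNIV"
  proof (subst Infinite_Sum.abs_summable_on_Sigma_iff, intro conjI ballI)
    have row: "(\<lambda>m. norm ((R\<^sup>2) ^ m / fact m)) summable_on UNIV"
      by (rule exp_abs)
    show "(\<lambda>m. norm (case (n, m) of (n, m) \<Rightarrow> ((3 * M * R) ^ n / fact n) * ((R\<^sup>2) ^ m / fact m))) summable_on UNIV" for n
      unfolding prod.case norm_mult by (intro summable_on_cmult_right row)
    have "norm (infsum (\<lambda>m. norm (case (n, m) of (n, m) \<Rightarrow> ((3 * M * R) ^ n / fact n) * ((R\<^sup>2) ^ m / fact m))) UNIV)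
        = norm ((3 * M * R) ^ n / fact n) * infsum (\<lambda>m. norm ((R\<^sup>2) ^ m / fact m)) UNIV" for n
    proof -
      have "0 \<le> infsum (\<lambda>m. norm ((R\<^sup>2) ^ m / fact m)) UNIV"
        by (rule infsum_nonneg) (rule norm_ge_zero)
      then show ?thesis
        unfolding prod.case norm_mult infsum_cmult_right' by (simp only: real_norm_def abs_abs abs_of_nonneg)
    qed
    moreover have "(\<lambda>n. norm ((3 * M * R) ^ n / fact n)) summable_on UNIV"
      by (rule exp_abs)
    ultimately show "(\<lambda>n. norm (infsum (\<lambda>m. norm (case (n, m) of (n, m) \<Rightarrow> ((3 * M * R) ^ n / fact n) * ((R\<^sup>2) ^ m / fact m))) UNIV)) summable_on UNIV"
      by (simp only:) (rule summable_on_cmult_left)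
  qed
  have T_le: "norm (T (n, m)) \<le> C * (((3 * M * R) ^ n / fact n) * ((R\<^sup>2) ^ m / fact m))" for n m
  proof -
    have "norm (2 * of_nat n + 1 :: complex) = 2 * real n + 1"
      using norm_of_nat[of "2 * n + 1", where ?'a = complex] by (simp add: add.commute)
    then have "norm (T (n, m)) = ((2 * real n + 1) * bessel_coeff m n) * (norm (?b n) * R ^ (2 * m + n))"
      by (simp add: T_def norm_mult norm_power R_def bessel_coeff_nonneg)
    also have "\<dots> \<le> (1 / (fact m * fact n)) * ((C * (3 * M) ^ n) * R ^ (2 * m + n))"
      by (intro mult_mono bessel_coeff_le norm_legendre_apply_le a M)
        (use M C in \<open>auto simp: R_def bessel_coeff_nonneg\<close>)
    also have "\<dots> = C * (((3 * M * R) ^ n / fact n) * ((R\<^sup>2) ^ m / fact m))"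
    proof -
      have "R ^ (2 * m + n) = (R\<^sup>2) ^ m * R ^ n" by (simp add: power_add power_mult)
      then show ?thesis by (simp add: power_mult_distrib mult_ac)
    qed
    finally show ?thesis .
  qed
  have "(\<lambda>x. norm (C * (case x of (n, m) \<Rightarrow> ((3 * M * R) ^ n / fact n) * ((R\<^sup>2) ^ m / fact m)))) summable_on UNIV \<times> UNIV"
    using summable_on_cmult_right[OF dom, of "norm C"] by (simp only: real_norm_def abs_mult abs_abs)
  then have "(\<lambda>x. norm (T x)) summable_on UNIV \<times> UNIV"
  proof (rule Infinite_Sum.abs_summable_on_comparison_test)
    fix x :: "nat \<times> nat"
    obtain n m where "x = (n, m)" by (cases x)
    then show "norm (T x) \<le> norm (C * (case x of (n, m) \<Rightarrow> ((3 * M * R) ^ n / fact n) * ((R\<^sup>2) ^ m / fact m)))"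
      using order_trans[OF T_le[of n m] abs_ge_self] by simp
  qed
  then have "T summable_on UNIV \<times> UNIV" by (rule abs_summable_summable)
  then have T: "(T has_sum infsum T (UNIV \<times> UNIV)) (UNIV \<times> UNIV)" by (rule has_sum_infsum)

  have row: "((\<lambda>m. T (n, m)) has_sum ((2 * of_nat n + 1) * \<i> ^ n * sph_bessel_j n z * ?b n)) UNIV" for n
  proof -
    have "(\<lambda>m. T (n, m)) summable_on UNIV"
      using summable_on_SigmaD1[of "\<lambda>n m. T (n, m)" UNIV "\<lambda>_. UNIV" n] \<open>T summable_on UNIV \<times> UNIV\<close> by simp
    then have hs: "((\<lambda>m. T (n, m)) has_sum infsum (\<lambda>m. T (n, m)) UNIV) UNIV" by (rule has_sum_infsum)
    have "(\<lambda>m. T (n, m)) sums ((2 * of_nat n + 1) * \<i> ^ n * ?b n * sph_bessel_j n z)"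
      unfolding T_def prod.case by (rule sums_mult[OF sph_bessel_j_sums])
    with has_sum_imp_sums[OF hs] have "infsum (\<lambda>m. T (n, m)) UNIV = (2 * of_nat n + 1) * \<i> ^ n * ?b n * sph_bessel_j n z"
      by (rule sums_unique2)
    with hs show ?thesis by (simp add: ac_simps)
  qed
  have rows: "(\<lambda>n. (2 * of_nat n + 1) * \<i> ^ n * sph_bessel_j n z * ?b n) sums infsum T (UNIV \<times> UNIV)"
    by (rule has_sum_imp_sums, rule has_sum_SigmaD[OF T]) (rule row)

  \<comment> \<open>The pairs (n, m) are regrouped by the total power N = n + 2m of z;
    \<open>D N\<close> collects the n that occur, and m is recovered as (N - n)/2.\<close>
  define D where "D = (\<lambda>N::nat. {n. n \<le> N \<and> even (N - n)})"
  have diag: "((\<lambda>(N, n). T (n, (N - n) div 2)) has_sum infsum T (UNIV \<times> UNIV)) (Sigma UNIV D)"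
  proof -
    have "(T has_sum infsum T (UNIV \<times> UNIV)) (UNIV \<times> UNIV) =
        ((\<lambda>(N, n). T (n, (N - n) div 2)) has_sum infsum T (UNIV \<times> UNIV)) (Sigma UNIV D)"
      by (rule has_sum_reindex_bij_witness[of _ "\<lambda>(N, n). (n, (N - n) div 2)" "\<lambda>(n, m). (n + 2 * m, n)"])
        (auto simp: D_def)
    with T show ?thesis by simp
  qed
  have diag_row: "((\<lambda>n. T (n, (N - n) div 2)) has_sum ((\<i> * z) ^ N / fact N * a N)) (D N)" for N
  proof -
    have fin: "finite (D N)" by (simp add: D_def)
    have T_eq: "T (n, (N - n) div 2) =
        (\<i> * z) ^ N * (of_real ((2 * real n + 1) * legendre_monom_coeff N n) * ?b n)" if "n \<in> D N" for n
    proof -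
      have n: "n \<le> N" "even (N - n)" using that unfolding D_def by blast+
      from n(2) obtain m where "N - n = 2 * m" by (rule dvdE)
      with n(1) have m: "N = n + 2 * m" by simp
      \<comment> \<open>The sign of the Bessel series turns i^n z^N into (i z)^N.\<close>
      have "(-1 :: complex) ^ m = \<i> ^ (2 * m)" by (simp add: power_mult)
      then show ?thesis
        by (simp add: m T_def legendre_monom_coeff_def power_mult_distrib power_add)
    qed
    have "(\<Sum>n\<in>D N. T (n, (N - n) div 2)) = (\<Sum>n\<in>D N. (\<i> * z) ^ N * (of_real ((2 * real n + 1) * legendre_monom_coeff N n) * ?b n))"
      by (intro sum.cong refl T_eq)
    also have "\<dots> = (\<Sum>n\<le>N. (\<i> * z) ^ N * (of_real ((2 * real n + 1) * legendre_monom_coeff N n) * ?b n))"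
      by (intro sum.mono_neutral_left) (auto simp: D_def legendre_monom_coeff_def)
    also have "\<dots> = (\<i> * z) ^ N / fact N * a N"
      by (simp only: sum_legendre_apply sum_distrib_left[symmetric]) simp
    finally show ?thesis using has_sum_finite[OF fin, of "\<lambda>n. T (n, (N - n) div 2)"] by simp
  qed
  have "(\<lambda>N. (\<i> * z) ^ N / fact N * a N) sums infsum T (UNIV \<times> UNIV)"
    by (rule has_sum_imp_sums, rule has_sum_SigmaD[OF diag]) (use diag_row in simp)
  then have "infsum T (UNIV \<times> UNIV) = S" using S by (rule sums_unique2)
  with rows show ?thesis by simp
qed

section \<open>Spectral parameter power series\<close>

lemma norm_integral_power_le:
  fixes f :: "real \<Rightarrow> complex"
  assumes "A \<le> y" "f integrable_on {A..y}"
    and "\<And>s. s \<in> {A..y} \<Longrightarrow> norm (f s) \<le> c * (s - A) ^ n"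
  shows "norm (integral {A..y} f) \<le> c * (y - A) ^ Suc n / real (Suc n)"
proof -
  let ?F = "\<lambda>s. c * (s - A) ^ Suc n / real (Suc n)"
  have hi: "((\<lambda>s. c * (s - A) ^ n) has_integral (?F y - ?F A)) {A..y}"
  proof (rule fundamental_theorem_of_calculus)
    fix s assume "s \<in> {A..y}"
    have "(?F has_field_derivative c * (real (Suc n) * (s - A) ^ n) / real (Suc n)) (at s within {A..y})"
      by (auto intro!: derivative_eq_intros simp del: of_nat_Suc power_Suc)
    then show "(?F has_vector_derivative c * (s - A) ^ n) (at s within {A..y})"
      by (simp add: has_real_derivative_iff_has_vector_derivative del: of_nat_Suc power_Suc)
  qed (use assms in auto)
  have "norm (integral {A..y} f) \<le> integral {A..y} (\<lambda>s. c * (s - A) ^ n)"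
    by (rule integral_norm_bound_integral) (use assms hi in \<open>auto intro: has_integral_integrable\<close>)
  also have "\<dots> = ?F y - ?F A" using hi by (rule integral_unique)
  finally show ?thesis by simp
qed

lemma continuous_bounded_Icc:
  fixes f :: "real \<Rightarrow> complex"
  assumes "continuous_on {A..B} f"
  shows "\<exists>K. \<forall>s\<in>{A..B}. norm (f s) \<le> K"
proof -
  have "bounded (f ` {A..B})"
    by (intro compact_imp_bounded compact_continuous_image assms compact_Icc)
  then show ?thesis by (simp add: bounded_iff)
qed

lemma bounded_family_Icc:
  fixes F :: "bool \<Rightarrow> real \<Rightarrow> complex"
  assumes "\<And>P. continuous_on {A..B} (F P)"
  shows "\<exists>K. \<forall>P. \<forall>s\<in>{A..B}. norm (F P s) \<le> K"
proof -
  obtain K1 where K1: "\<forall>s\<in>{A..B}. norm (F True s) \<le> K1"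
    using continuous_bounded_Icc[OF assms] by metis
  obtain K2 where K2: "\<forall>s\<in>{A..B}. norm (F False s) \<le> K2"
    using continuous_bounded_Icc[OF assms] by metis
  have "norm (F P s) \<le> max K1 K2" if "s \<in> {A..B}" for P s
    using K1 K2 that by (cases P) (simp_all add: le_max_iff_disj)
  then show ?thesis by metis
qed

text \<open>
  The weight that turns \<open>X n\<close> into \<open>X (Suc n)\<close> is \<open>W True\<close> if \<open>Suc n\<close> is even and \<open>W False\<close>
  otherwise; both families of formal powers are instances.
\<close>

locale iterated_integrals =
  fixes A B :: real and W :: "bool \<Rightarrow> real \<Rightarrow> complex" and X :: "nat \<Rightarrow> real \<Rightarrow> complex"
  assumes continuous_W: "continuous_on {A..B} (W P)"
    and X_0: "X 0 y = 1"
    and X_Suc: "X (Suc n) y = of_nat (Suc n) * integral {A..y} (\<lambda>s. X n s * W (odd n) s)"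
begin

lemma continuous_X: "continuous_on {A..B} (X n)"
proof (induction n)
  case 0
  have "X 0 = (\<lambda>_. 1)" by (auto simp: X_0)
  then show ?case by simp
next
  case (Suc n)
  have "continuous_on {A..B} (\<lambda>s. X n s * W (odd n) s)"
    by (intro continuous_intros Suc continuous_W)
  then have "(\<lambda>s. X n s * W (odd n) s) integrable_on {A..B}"
    by (rule integrable_continuous_interval)
  then have "continuous_on {A..B} (\<lambda>y. of_nat (Suc n) * integral {A..y} (\<lambda>s. X n s * W (odd n) s))"
    by (intro continuous_intros indefinite_integral_continuous_1)
  moreover have "X (Suc n) = (\<lambda>y. of_nat (Suc n) * integral {A..y} (\<lambda>s. X n s * W (odd n) s))"
    by (auto simp: X_Suc)
  ultimately show ?case by simp
qed

text \<open>No factorial appears: the factor \<open>Suc n\<close> in the recursion cancels the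
  1/(n+1) gained by integrating (s - A)^n.\<close>

lemma norm_X_le:
  assumes K: "\<And>P s. s \<in> {A..B} \<Longrightarrow> norm (W P s) \<le> K" and y: "y \<in> {A..B}"
  shows "norm (X n y) \<le> (K * (y - A)) ^ n"
  using y
proof (induction n arbitrary: y)
  case 0
  then show ?case by (simp add: X_0)
next
  case (Suc n)
  have sub: "{A..y} \<subseteq> {A..B}" using Suc.prems by auto
  have "0 \<le> K" using order_trans[OF norm_ge_zero K[of y True]] Suc.prems by simp
  have "norm (integral {A..y} (\<lambda>s. X n s * W (odd n) s)) \<le> (K ^ n * K) * (y - A) ^ Suc n / real (Suc n)"
  proof (rule norm_integral_power_le)
    show "(\<lambda>s. X n s * W (odd n) s) integrable_on {A..y}"
      by (intro integrable_continuous_interval continuous_intros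
          continuous_on_subset[OF continuous_X sub] continuous_on_subset[OF continuous_W sub])
    fix s assume s: "s \<in> {A..y}"
    then have "norm (X n s * W (odd n) s) \<le> (K * (s - A)) ^ n * K"
      unfolding norm_mult using sub \<open>0 \<le> K\<close> by (intro mult_mono Suc.IH K) auto
    then show "norm (X n s * W (odd n) s) \<le> (K ^ n * K) * (s - A) ^ n"
      by (simp add: power_mult_distrib mult_ac)
  qed (use Suc.prems in auto)
  then have "real (Suc n) * norm (integral {A..y} (\<lambda>s. X n s * W (odd n) s))
      \<le> real (Suc n) * ((K ^ n * K) * (y - A) ^ Suc n / real (Suc n))"
    by (rule mult_left_mono) simp
  also have "\<dots> = (K * (y - A)) ^ Suc n"
    by (simp add: power_mult_distrib mult_ac del: of_nat_Suc)
  finally show ?case unfolding X_Suc norm_mult norm_of_nat .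
qed

text \<open>The pair \<open>U True\<close>, \<open>U False\<close> solves a first order system with
  the two weights and starts at 1 and 0. Its power series in c has the X k as coefficients, even k
  belonging to \<open>U True\<close> and odd k to \<open>U False\<close>.\<close>

context
  fixes c :: complex and U :: "bool \<Rightarrow> real \<Rightarrow> complex"
  assumes U_deriv: "\<And>P y. y \<in> {A..B} \<Longrightarrow>
      (U P has_vector_derivative c * (W P y * U (\<not> P) y)) (at y within {A..B})"
    and U_A: "\<And>P. U P A = of_bool P"
begin

lemma continuous_U: "continuous_on {A..B} (U P)"
  by (rule continuous_on_vector_derivative) (rule U_deriv)

definition partial :: "bool \<Rightarrow> nat \<Rightarrow> real \<Rightarrow> complex" where
  "partial P N y = (\<Sum>k<N. if even k = P then c ^ k * X k y / fact k else 0)"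

text \<open>The partial sums are the Picard iterates of the integral form of the system: each
  integration raises the degree by one and swaps the two components.\<close>

lemma partial_Suc:
  assumes y: "y \<in> {A..B}"
  shows "partial P (Suc N) y = of_bool P + c * integral {A..y} (\<lambda>s. W P s * partial (\<not> P) N s)"
proof -
  have sub: "{A..y} \<subseteq> {A..B}" using y by auto
  have int: "(\<lambda>s. W P s * X k s) integrable_on {A..y}" for k
    by (intro integrable_continuous_interval continuous_intros
        continuous_on_subset[OF continuous_X sub] continuous_on_subset[OF continuous_W sub])
  have step: "(if even (Suc k) = P then c ^ Suc k * X (Suc k) y / fact (Suc k) else 0) =
      c * integral {A..y} (\<lambda>s. (if even k = (\<not> P) then c ^ k / fact k else 0) * (W P s * X k s))" for k
  proof (cases "even k = (\<not> P)")
    case True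
    then have "X (Suc k) y = of_nat (Suc k) * integral {A..y} (\<lambda>s. W P s * X k s)"
      unfolding X_Suc by (simp add: mult.commute)
    with True show ?thesis by (simp add: fact_Suc divide_simps del: of_nat_Suc)
  qed auto
  have "partial P (Suc N) y = of_bool P + (\<Sum>k<N. if even (Suc k) = P then c ^ Suc k * X (Suc k) y / fact (Suc k) else 0)"
    unfolding partial_def by (subst sum.lessThan_Suc_shift) (auto simp: X_0)
  also have "\<dots> = of_bool P + c * (\<Sum>k<N. integral {A..y} (\<lambda>s. (if even k = (\<not> P) then c ^ k / fact k else 0) * (W P s * X k s)))"
    unfolding step sum_distrib_left ..
  also have "(\<Sum>k<N. integral {A..y} (\<lambda>s. (if even k = (\<not> P) then c ^ k / fact k else 0) * (W P s * X k s)))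
     = integral {A..y} (\<lambda>s. \<Sum>k<N. (if even k = (\<not> P) then c ^ k / fact k else 0) * (W P s * X k s))"
    by (rule integral_sum[symmetric]) (auto intro: integrable_on_mult_right int)
  also have "(\<lambda>s. \<Sum>k<N. (if even k = (\<not> P) then c ^ k / fact k else 0) * (W P s * X k s)) =
      (\<lambda>s. W P s * partial (\<not> P) N s)"
    unfolding partial_def sum_distrib_left by (intro ext sum.cong) auto
  finally show ?thesis .
qed

lemma continuous_partial: "continuous_on {A..B} (partial P N)"
proof -
  have "continuous_on {A..B} (\<lambda>y. if even k = P then c ^ k * X k y / fact k else 0)" for k
    by (cases "even k = P") (auto intro!: continuous_intros continuous_X)
  then have "continuous_on {A..B} (\<lambda>y. \<Sum>k<N. if even k = P then c ^ k * X k y / fact k else 0)"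
    by (rule continuous_on_sum)
  then show ?thesis by (simp add: partial_def [abs_def])
qed

text \<open>U satisfies the same integral equation as the Picard step, so the remainder obeys a
  Volterra recursion without inhomogeneous term. Each pass contributes one integration, and N passes
  give 1/N!.\<close>

lemma norm_remainder_le:
  assumes K: "\<And>P s. s \<in> {A..B} \<Longrightarrow> norm (W P s) \<le> K"
    and M: "\<And>P s. s \<in> {A..B} \<Longrightarrow> norm (U P s) \<le> M"
    and y: "y \<in> {A..B}"
  shows "norm (U P y - partial P N y) \<le> M * (norm c * K * (y - A)) ^ N / fact N"
  using y
proof (induction N arbitrary: y P)
  case 0
  then show ?case by (simp add: partial_def M)
next
  case (Suc N)
  have sub: "{A..y} \<subseteq> {A..B}" using Suc.prems by auto
  have K0: "0 \<le> K" using order_trans[OF norm_ge_zero K[of y True]] Suc.prems by simp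
  have "integral {A..y} (\<lambda>s. c * (W P s * U (\<not> P) s)) = U P y - U P A"
    by (rule integral_unique, rule fundamental_theorem_of_calculus)
      (use Suc.prems sub in \<open>auto intro: has_vector_derivative_within_subset[OF U_deriv]\<close>)
  then have U_eq: "U P y = of_bool P + c * integral {A..y} (\<lambda>s. W P s * U (\<not> P) s)"
    by (simp only: integral_mult_right U_A) simp
  have int: "(\<lambda>s. W P s * f s) integrable_on {A..y}" if "continuous_on {A..B} f" for f
    by (intro integrable_continuous_interval continuous_intros
        continuous_on_subset[OF that sub] continuous_on_subset[OF continuous_W sub])
  have "U P y - partial P (Suc N) y =
      c * (integral {A..y} (\<lambda>s. W P s * U (\<not> P) s) - integral {A..y} (\<lambda>s. W P s * partial (\<not> P) N s))"
    unfolding U_eq partial_Suc[OF Suc.prems] by (simp add: algebra_simps)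
  also have "integral {A..y} (\<lambda>s. W P s * U (\<not> P) s) - integral {A..y} (\<lambda>s. W P s * partial (\<not> P) N s)
     = integral {A..y} (\<lambda>s. W P s * U (\<not> P) s - W P s * partial (\<not> P) N s)"
    by (rule integral_diff[symmetric]) (intro int continuous_U continuous_partial)+
  finally have "norm (U P y - partial P (Suc N) y) =
      norm c * norm (integral {A..y} (\<lambda>s. W P s * U (\<not> P) s - W P s * partial (\<not> P) N s))"
    by (simp add: norm_mult)
  also have "\<dots> \<le> norm c * ((K * M * (norm c * K) ^ N / fact N) * (y - A) ^ Suc N / real (Suc N))"
  proof (intro mult_left_mono norm_integral_power_le)
    show "(\<lambda>s. W P s * U (\<not> P) s - W P s * partial (\<not> P) N s) integrable_on {A..y}"
      by (intro integrable_diff int continuous_U continuous_partial)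
    fix s assume s: "s \<in> {A..y}"
    have "norm (W P s * U (\<not> P) s - W P s * partial (\<not> P) N s) = norm (W P s) * norm (U (\<not> P) s - partial (\<not> P) N s)"
      by (simp add: norm_mult flip: right_diff_distrib)
    also have "\<dots> \<le> K * (M * (norm c * K * (s - A)) ^ N / fact N)"
      using s sub K0 by (intro mult_mono K Suc.IH) auto
    finally show "norm (W P s * U (\<not> P) s - W P s * partial (\<not> P) N s) \<le> (K * M * (norm c * K) ^ N / fact N) * (s - A) ^ N"
      by (simp add: power_mult_distrib mult_ac)
  qed (use Suc.prems in auto)
  also have "\<dots> = M * (norm c * K * (y - A)) ^ Suc N / fact (Suc N)"
    by (simp add: power_mult_distrib fact_Suc mult_ac del: of_nat_Suc)
  finally show ?case .
qed

theorem spectral_power_series: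
  assumes y: "y \<in> {A..B}"
  shows "(\<lambda>k. if even k = P then c ^ k * X k y / fact k else 0) sums U P y"
proof -
  obtain K where "\<forall>P. \<forall>s\<in>{A..B}. norm (W P s) \<le> K"
    using bounded_family_Icc[where F = W, OF continuous_W] by metis
  then have K: "norm (W P s) \<le> K" if "s \<in> {A..B}" for P s
    using that by simp
  obtain M where "\<forall>P. \<forall>s\<in>{A..B}. norm (U P s) \<le> M"
    using bounded_family_Icc[where F = U, OF continuous_U] by metis
  then have M: "norm (U P s) \<le> M" if "s \<in> {A..B}" for P s
    using that by simp
  let ?r = "\<lambda>N. (norm c * K * (y - A)) ^ N / fact N"
  have "?r \<longlonglongrightarrow> 0"
    using summable_LIMSEQ_zero[OF summable_exp[of "norm c * K * (y - A)"]] by (simp only: divide_inverse_commute)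
  then have "(\<lambda>N. M * (norm c * K * (y - A)) ^ N / fact N) \<longlonglongrightarrow> 0"
    using tendsto_mult_right_zero[of ?r sequentially "M"] by simp
  then have "(\<lambda>N. U P y - partial P N y) \<longlonglongrightarrow> 0"
    by (rule Lim_null_comparison[rotated]) (use norm_remainder_le[OF K M y] in auto)
  then have "(\<lambda>N. partial P N y) \<longlonglongrightarrow> U P y"
    using tendsto_diff[OF tendsto_const[of "U P y"]] by fastforce
  then show ?thesis by (simp add: sums_def partial_def)
qed

end

end

section \<open>Parity splitting\<close>

text \<open>P_n contains only powers of the parity of n, so moments of the other parity are
  invisible to it.\<close>

lemma legendre_apply_eq_0:
  assumes "\<And>k. even k = even n \<Longrightarrow> a k = 0"
  shows "legendre_apply a n = 0"
  unfolding legendre_apply_def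
proof (intro sum.neutral ballI)
  show "of_real (coeff (legendre_poly n) k) * a k = 0" for k
    using assms[of k] coeff_legendre_eq_0[of n k] by (cases "even k = even n") auto
qed

lemma legendre_apply_cong_parity:
  assumes "\<And>k. even k = even n \<Longrightarrow> a k = b k"
  shows "legendre_apply a n = legendre_apply b n"
  unfolding legendre_apply_def
proof (intro sum.cong refl)
  show "of_real (coeff (legendre_poly n) k) * a k = of_real (coeff (legendre_poly n) k) * b k" for k
    using assms[of k] coeff_legendre_eq_0[of n k] by (cases "even k = even n") auto
qed

lemma neumann_series_even:
  assumes a: "\<And>k. norm (a k) \<le> C * M ^ k" and M: "M \<ge> 1" and odd: "\<And>k. odd k \<Longrightarrow> a k = 0"
    and S: "(\<lambda>k. (\<i> * z) ^ k / fact k * a k) sums S"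
  shows "(\<lambda>n. (2 * of_nat (2 * n) + 1) * ((-1) ^ n * sph_bessel_j (2 * n) z * legendre_apply a (2 * n))) sums S"
proof -
  let ?f = "\<lambda>n. (2 * of_nat n + 1) * \<i> ^ n * sph_bessel_j n z * legendre_apply a n"
  have "(\<lambda>n. ?f (2 * n)) sums S \<longleftrightarrow> ?f sums S"
  proof (rule sums_mono_reindex)
    show "strict_mono (\<lambda>n::nat. 2 * n)" by (simp add: strict_mono_def)
    fix n :: nat assume "n \<notin> range (\<lambda>n. 2 * n)"
    then have "odd n" by (auto elim!: evenE)
    then have "legendre_apply a n = 0" by (intro legendre_apply_eq_0) (simp add: odd)
    then show "?f n = 0" by simp
  qed
  then have "(\<lambda>n. ?f (2 * n)) sums S" using neumann_series_legendre[OF a M S] by simp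
  moreover have "c * \<i> ^ (2 * n) * j * l = c * ((-1) ^ n * j * l)" for c j l :: complex and n
    by (simp add: power_mult)
  ultimately show ?thesis by (simp only:)
qed

text \<open>The factor -i removes the extra i in i^(2n+1) = i (-1)^n.\<close>

lemma neumann_series_odd:
  assumes a: "\<And>k. norm (a k) \<le> C * M ^ k" and M: "M \<ge> 1" and even: "\<And>k. even k \<Longrightarrow> a k = 0"
    and S: "(\<lambda>k. (\<i> * z) ^ k / fact k * a k) sums S"
  shows "(\<lambda>n. (2 * of_nat (2 * n + 1) + 1) *
    ((-1) ^ n * sph_bessel_j (2 * n + 1) z * legendre_apply a (2 * n + 1))) sums (- \<i> * S)"
proof -
  let ?f = "\<lambda>n. (2 * of_nat n + 1) * \<i> ^ n * sph_bessel_j n z * legendre_apply a n"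
  have "(\<lambda>n. ?f (2 * n + 1)) sums S \<longleftrightarrow> ?f sums S"
  proof (rule sums_mono_reindex)
    show "strict_mono (\<lambda>n::nat. 2 * n + 1)" by (simp add: strict_mono_def)
    fix n :: nat assume "n \<notin> range (\<lambda>n. 2 * n + 1)"
    then have "even n" by (metis oddE range_eqI)
    then have "legendre_apply a n = 0" by (intro legendre_apply_eq_0) (simp add: even)
    then show "?f n = 0" by simp
  qed
  then have "(\<lambda>n. ?f (2 * n + 1)) sums S" using neumann_series_legendre[OF a M S] by simp
  then have "(\<lambda>n. - \<i> * ?f (2 * n + 1)) sums (- \<i> * S)" by (rule sums_mult)
  moreover have "- \<i> * (c * \<i> ^ (2 * n + 1) * j * l) = c * ((-1) ^ n * j * l)" for c j l :: complex and n
  proof -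
    have "- \<i> * (c * (\<i> * (-1) ^ n) * j * l) = - (\<i> * \<i>) * (c * ((-1) ^ n * j * l))"
      by (simp only: mult_ac minus_mult_left minus_mult_right)
    then show ?thesis by (simp add: power_mult)
  qed
  ultimately show ?thesis by (simp only:)
qed

section \<open>Cancellation of the trigonometric terms\<close>

text \<open>The even part (P) and the odd part (not P) of exp(i z).\<close>

definition trig_part :: "bool \<Rightarrow> complex \<Rightarrow> complex" where
  "trig_part P z = (if P then cos z else \<i> * sin z)"

lemma trig_part_sums:
  "(\<lambda>k. if even k = P then (\<i> * z) ^ k / fact k else 0) sums trig_part P z"
proof (cases P)
  case True
  have "(if even k = True then (\<i> * z) ^ k / fact k else 0) = cos_coeff k *\<^sub>R z ^ k" for k
    by (auto simp: cos_coeff_def power_mult_distrib power_mult scaleR_conv_of_real elim!: evenE)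
  then show ?thesis using cos_converges[of z] True by (simp add: trig_part_def)
next
  case False
  have "(if even k = False then (\<i> * z) ^ k / fact k else 0) = \<i> * (sin_coeff k *\<^sub>R z ^ k)" for k
    by (auto simp: sin_coeff_def power_mult_distrib power_mult scaleR_conv_of_real elim!: oddE)
  then show ?thesis using sums_mult[OF sin_converges[of z], of \<i>] False by (simp add: trig_part_def)
qed

text \<open>An index shift exchanges the parities. It handles every summand with a factor k that
  cancels against k!, first in the trigonometric series and later in k \<Psi>_(k-1).\<close>

lemma sums_shift_parity:
  fixes f h :: "nat \<Rightarrow> complex"
  assumes "(\<lambda>k. if even k = (\<not> P) then h k else 0) sums s"
    and "f 0 = 0" and "\<And>k. even k = (\<not> P) \<Longrightarrow> f (Suc k) = h k"
  shows "(\<lambda>k. if even k = P then f k else 0) sums s"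
proof -
  have "(\<lambda>k. if even (Suc k) = P then f (Suc k) else 0) = (\<lambda>k. if even k = (\<not> P) then h k else 0)"
    using assms(3) by (intro ext) (cases P; simp)
  then have "(\<lambda>k. if even (Suc k) = P then f (Suc k) else 0) sums s" using assms(1) by simp
  then have "(\<lambda>k. if even k = P then f k else 0) sums (s + (if even (0::nat) = P then f 0 else 0))"
    by (rule sums_Suc)
  then show ?thesis using assms(2) by (simp split: if_splits)
qed

text \<open>The operator z d/dz applied to \<open>trig_part_sums\<close>; it maps each part of exp(i
  z) to i z times the other part.\<close>

lemma trig_part_deriv_sums:
  "(\<lambda>k. if even k = P then of_nat k * (\<i> * z) ^ k / fact k else 0) sums (\<i> * z * trig_part (\<not> P) z)"
proof (rule sums_shift_parity)
  have "(\<lambda>k. \<i> * z * (if even k = (\<not> P) then (\<i> * z) ^ k / fact k else 0)) sums (\<i> * z * trig_part (\<not> P) z)"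
    by (rule sums_mult[OF trig_part_sums])
  also have "(\<lambda>k. \<i> * z * (if even k = (\<not> P) then (\<i> * z) ^ k / fact k else 0)) =
    (\<lambda>k. if even k = (\<not> P) then \<i> * z * ((\<i> * z) ^ k / fact k) else 0)" by auto
  finally show "(\<lambda>k. if even k = (\<not> P) then \<i> * z * ((\<i> * z) ^ k / fact k) else 0) sums (\<i> * z * trig_part (\<not> P) z)" .
  show "of_nat (Suc k) * (\<i> * z) ^ Suc k / fact (Suc k) = \<i> * z * ((\<i> * z) ^ k / fact k)" for k
    by (simp add: fact_Suc del: of_nat_Suc)
qed simp

text \<open>
  The bracket in the definition of \<open>\<mu>\<^sub>n\<close>: the functional with moments \<open>d k / x\<^sup>k\<close>, corrected by
  \<open>P\<^sub>n'(1) / x\<close> and \<open>G P\<^sub>n(1)\<close>.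
\<close>

definition mu_bracket :: "(nat \<Rightarrow> complex) \<Rightarrow> real \<Rightarrow> complex \<Rightarrow> nat \<Rightarrow> complex" where
  "mu_bracket d x G n = legendre_apply (\<lambda>k. d k / of_real x ^ k) n
     - of_real (real n * (real n + 1) / (2 * x)) - G"

text \<open>By linearity in the moments, the three pieces of the bracket contribute D, the
  derivative term and G times the trigonometric part. In the derivative term z/x = \<omega>, which
  leaves \<omega> sin z or \<omega> cos z without a factor x.\<close>

lemma neumann_mu_bracket:
  assumes d: "\<And>k. norm (d k) \<le> C * L ^ k" and L: "L \<ge> 1" and x: "x > 0"
    and D: "(\<lambda>k. if even k = P then (\<i> * \<omega>) ^ k * d k / fact k else 0) sums D"
  defines "z \<equiv> \<omega> * of_real x"
  shows "P \<Longrightarrow> (\<lambda>n. (2 * of_nat (2 * n) + 1) * ((-1) ^ n * sph_bessel_j (2 * n) z * mu_bracket d x G (2 * n)))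
      sums (D + \<omega> * sin z - G * cos z)"
    and "\<not> P \<Longrightarrow> (\<lambda>n. (2 * of_nat (2 * n + 1) + 1) * ((-1) ^ n * sph_bessel_j (2 * n + 1) z * mu_bracket d x G (2 * n + 1)))
      sums (- \<i> * D - \<omega> * cos z - G * sin z)"
proof -
  define e where "e = (\<lambda>k. d k / of_real x ^ k - of_nat k / of_real x - G)"
  \<comment> \<open>The series D covers one parity only, so the moments of the other parity are set
    to 0; the values of the functional at P_n with n of parity P are unaffected.\<close>
  define \<alpha> where "\<alpha> = (\<lambda>k. if even k = P then e k else 0)"
  \<comment> \<open>L (1 + 1/x) dominates L/x for the moments, and the factor 2 makes M^k dominate
    k.\<close>
  define M where "M = 2 * (L * (1 + 1 / x))"
  have "norm (d 0) \<le> C * L ^ 0" by (rule d)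
  then have C: "0 \<le> C" using norm_ge_zero[of "d 0"] by (simp del: norm_ge_zero)
  have M1: "1 \<le> L * (1 + 1 / x)"
    using mult_mono[of 1 L 1 "1 + 1 / x"] L x by simp
  then have M: "M \<ge> 1" "2 \<le> M" by (simp_all add: M_def)
  have \<alpha>_le: "norm (\<alpha> k) \<le> (C + 1 / x + norm G) * M ^ k" for k
  proof -
    have 1: "norm (d k / of_real x ^ k) \<le> C * M ^ k"
    proof -
      have "norm (d k / of_real x ^ k) = norm (d k) * (1 / x) ^ k"
        using x by (simp add: norm_divide norm_power power_divide)
      also have "\<dots> \<le> (C * L ^ k) * (1 / x) ^ k"
        using x by (intro mult_right_mono d) auto
      also have "\<dots> = C * (L * (1 / x)) ^ k" by (simp only: power_mult_distrib mult.assoc)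
      also have "\<dots> \<le> C * M ^ k"
        using x L C by (intro mult_left_mono power_mono) (auto simp: M_def field_simps)
      finally show ?thesis .
    qed
    have "real k \<le> 2 ^ k" using of_nat_mono[OF less_imp_le[OF less_exp[of k]]] by simp
    also have "\<dots> \<le> M ^ k" using M by (intro power_mono) auto
    finally have "real k / x \<le> M ^ k / x" using x by (intro divide_right_mono) auto
    then have 2: "norm (of_nat k / of_real x :: complex) \<le> 1 / x * M ^ k"
      using x by (simp add: norm_divide)
    have 3: "norm G \<le> norm G * M ^ k"
      using M by (simp add: mult_le_cancel_left1 one_le_power)
    have "norm (\<alpha> k) \<le> norm (d k / of_real x ^ k) + norm (of_nat k / of_real x :: complex) + norm G"
      unfolding \<alpha>_def e_def using norm_triangle_ineq4[of "d k / of_real x ^ k - of_nat k / of_real x" G]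
        norm_triangle_ineq4[of "d k / of_real x ^ k" "of_nat k / of_real x"] norm_ge_zero[of G]
        norm_ge_zero[of "d k / of_real x ^ k"] norm_ge_zero[of "of_nat k / of_real x :: complex"]
      by (auto simp del: norm_ge_zero)
    then show ?thesis using 1 2 3 by (simp add: algebra_simps)
  qed
  have S: "(\<lambda>k. (\<i> * z) ^ k / fact k * \<alpha> k) sums
      (D - 1 / of_real x * (\<i> * z * trig_part (\<not> P) z) - G * trig_part P z)"
  proof -
    have "(\<lambda>k. (if even k = P then (\<i> * \<omega>) ^ k * d k / fact k else 0)
        - 1 / of_real x * (if even k = P then of_nat k * (\<i> * z) ^ k / fact k else 0)
        - G * (if even k = P then (\<i> * z) ^ k / fact k else 0)) sums
      (D - 1 / of_real x * (\<i> * z * trig_part (\<not> P) z) - G * trig_part P z)"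
      by (intro sums_diff sums_mult D trig_part_sums trig_part_deriv_sums)
    moreover have "(\<lambda>k. (if even k = P then (\<i> * \<omega>) ^ k * d k / fact k else 0)
        - 1 / of_real x * (if even k = P then of_nat k * (\<i> * z) ^ k / fact k else 0)
        - G * (if even k = P then (\<i> * z) ^ k / fact k else 0)) = (\<lambda>k. (\<i> * z) ^ k / fact k * \<alpha> k)"
    proof (rule ext)
      fix k
      have "(\<i> * \<omega>) ^ k * d k / fact k = (\<i> * z) ^ k / fact k * (d k / of_real x ^ k)"
        using x by (simp add: z_def power_mult_distrib)
      then show "(if even k = P then (\<i> * \<omega>) ^ k * d k / fact k else 0)
        - 1 / of_real x * (if even k = P then of_nat k * (\<i> * z) ^ k / fact k else 0)
        - G * (if even k = P then (\<i> * z) ^ k / fact k else 0) = (\<i> * z) ^ k / fact k * \<alpha> k"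
        by (simp add: \<alpha>_def e_def right_diff_distrib diff_divide_distrib mult_ac)
    qed
    ultimately show ?thesis by (simp only:)
  qed
  have bracket: "legendre_apply \<alpha> n = mu_bracket d x G n" if "even n = P" for n
  proof -
    have "legendre_apply \<alpha> n = legendre_apply e n"
      using that by (intro legendre_apply_cong_parity) (simp add: \<alpha>_def)
    also have "\<dots> = legendre_apply (\<lambda>k. d k / of_real x ^ k) n
        - of_real (\<Sum>k\<le>n. coeff (legendre_poly n) k * real k) / of_real x
        - G * of_real (\<Sum>k\<le>n. coeff (legendre_poly n) k)"
      unfolding legendre_apply_def e_def
      by (simp add: right_diff_distrib sum_subtractf sum_divide_distrib sum_distrib_left mult_ac)
    also have "\<dots> = mu_bracket d x G n"
      unfolding sum_coeff_legendre sum_coeff_legendre_deriv mu_bracket_def by (simp add: mult_ac)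
    finally show ?thesis .
  qed
  have zx: "1 / of_real x * (\<i> * z * w) = \<i> * \<omega> * w" for w
    using x by (simp add: z_def)
  show "(\<lambda>n. (2 * of_nat (2 * n) + 1) * ((-1) ^ n * sph_bessel_j (2 * n) z * mu_bracket d x G (2 * n)))
      sums (D + \<omega> * sin z - G * cos z)" if P
  proof -
    have "(\<lambda>n. (2 * of_nat (2 * n) + 1) * ((-1) ^ n * sph_bessel_j (2 * n) z * legendre_apply \<alpha> (2 * n)))
      sums (D - 1 / of_real x * (\<i> * z * trig_part (\<not> P) z) - G * trig_part P z)"
      by (rule neumann_series_even[OF \<alpha>_le M(1) _ S]) (use that in \<open>simp add: \<alpha>_def\<close>)
    moreover have "D - 1 / of_real x * (\<i> * z * trig_part (\<not> P) z) - G * trig_part P z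
        = D + \<omega> * sin z - G * cos z"
    proof -
      have "\<i> * \<omega> * (\<i> * sin z) = (\<i> * \<i>) * (\<omega> * sin z)" by (simp only: mult_ac)
      then show ?thesis unfolding zx using that by (simp add: trig_part_def)
    qed
    moreover have "legendre_apply \<alpha> (2 * n) = mu_bracket d x G (2 * n)" for n
      using that by (intro bracket) simp
    ultimately show ?thesis by (simp only:)
  qed
  show "(\<lambda>n. (2 * of_nat (2 * n + 1) + 1) * ((-1) ^ n * sph_bessel_j (2 * n + 1) z * mu_bracket d x G (2 * n + 1)))
      sums (- \<i> * D - \<omega> * cos z - G * sin z)" if "\<not> P"
  proof -
    have "(\<lambda>n. (2 * of_nat (2 * n + 1) + 1) * ((-1) ^ n * sph_bessel_j (2 * n + 1) z * legendre_apply \<alpha> (2 * n + 1)))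
      sums (- \<i> * (D - 1 / of_real x * (\<i> * z * trig_part (\<not> P) z) - G * trig_part P z))"
      by (rule neumann_series_odd[OF \<alpha>_le M(1) _ S]) (use that in \<open>simp add: \<alpha>_def\<close>)
    moreover have "- \<i> * (D - 1 / of_real x * (\<i> * z * trig_part (\<not> P) z) - G * trig_part P z)
        = - \<i> * D - \<omega> * cos z - G * sin z"
      unfolding zx using that by (simp add: trig_part_def algebra_simps)
    moreover have "legendre_apply \<alpha> (2 * n + 1) = mu_bracket d x G (2 * n + 1)" for n
      using that by (intro bracket) simp
    ultimately show ?thesis by (simp only:)
  qed
qed

lemma sph_bessel_j_0_right:
  assumes "n > 0"
  shows "sph_bessel_j n 0 = 0"
  using sph_bessel_j_sums[of n 0] assms by (simp add: power_0_left sums_iff)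

section \<open>The Sturm--Liouville problem\<close>

lemma abs_continuous_Icc_imp_continuous_on:
  assumes "abs_continuous_Icc A B f"
  shows "continuous_on {A..B} f"
  unfolding continuous_on_iff
proof (intro ballI allI impI)
  fix x e :: real assume x: "x \<in> {A..B}" and "e > 0"
  then obtain \<delta> where \<delta>: "\<delta> > 0" and small: "\<And>I :: (real \<times> real) set.
        finite I \<and> (\<forall>(a, b)\<in>I. A \<le> a \<and> a < b \<and> b \<le> B) \<and>
        pairwise (\<lambda>i j. {fst i<..<snd i} \<inter> {fst j<..<snd j} = {}) I \<and>
        (\<Sum>(a, b)\<in>I. b - a) < \<delta> \<Longrightarrow>
        (\<Sum>(a, b)\<in>I. \<bar>f b - f a\<bar>) < e"
    using assms unfolding abs_continuous_Icc_def by meson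
  show "\<exists>d>0. \<forall>x'\<in>{A..B}. dist x' x < d \<longrightarrow> dist (f x') (f x) < e"
  proof (intro exI conjI ballI impI)
    fix x' assume x': "x' \<in> {A..B}" "dist x' x < \<delta>"
    show "dist (f x') (f x) < e"
    proof (cases "x' = x")
      case False
      then consider "x < x'" | "x' < x" by linarith
      then show ?thesis
      proof cases
        case 1
        then show ?thesis using small[of "{(x, x')}"] x x' by (simp add: dist_real_def)
      next
        case 2
        then show ?thesis using small[of "{(x', x)}"] x x' by (simp add: dist_real_def abs_minus_commute)
      qed
    qed (use \<open>e > 0\<close> in simp)
  qed (rule \<delta>)
qed

lemma sl_solutionD:
  assumes "sl_solution A B p q r c u" "y \<in> {A..B}"
  shows "(u has_vector_derivative deriv_Icc A B u y) (at y within {A..B})"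
    and "((\<lambda>s. of_real (p s) * deriv_Icc A B u s) has_vector_derivative
          (q y * u y - c * of_real (r y) * u y)) (at y within {A..B})"
proof -
  show "(u has_vector_derivative deriv_Icc A B u y) (at y within {A..B})"
    using assms unfolding sl_solution_def differentiable_on_def by (simp add: vector_derivative_works)
  have "((\<lambda>s. of_real (p s) * deriv_Icc A B u s) has_vector_derivative
      deriv_Icc A B (\<lambda>s. of_real (p s) * deriv_Icc A B u s) y) (at y within {A..B})"
    using assms unfolding sl_solution_def differentiable_on_def by (simp add: vector_derivative_works)
  moreover have "deriv_Icc A B (\<lambda>s. of_real (p s) * deriv_Icc A B u s) y = q y * u y - c * of_real (r y) * u y"
    using assms unfolding sl_solution_def by (auto simp: algebra_simps)
  ultimately show "((\<lambda>s. of_real (p s) * deriv_Icc A B u s) has_vector_derivative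
          (q y * u y - c * of_real (r y) * u y)) (at y within {A..B})" by simp
qed

locale sl_problem =
  fixes A B :: real and p r :: "real \<Rightarrow> real" and q g :: "real \<Rightarrow> complex"
  assumes AB: "A < B"
    and q_cont: "continuous_on {A..B} q"
    and p_diff: "p differentiable_on {A..B}"
    and r_diff: "r differentiable_on {A..B}"
    and p'_cont: "continuous_on {A..B} (deriv_Icc A B p)"
    and r'_cont: "continuous_on {A..B} (deriv_Icc A B r)"
    and p_pos: "\<And>y. y \<in> {A..B} \<Longrightarrow> p y > 0"
    and r_pos: "\<And>y. y \<in> {A..B} \<Longrightarrow> r y > 0"
    and g_sol: "sl_solution A B p q r 0 g"
    and g_A: "g A = of_real (1 / sl_rho p r A)"
    and g_nz: "\<And>y. y \<in> {A..B} \<Longrightarrow> g y \<noteq> 0"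
begin

abbreviation "\<rho> \<equiv> sl_rho p r"
abbreviation "\<rho>' \<equiv> deriv_Icc A B (sl_rho p r)"
abbreviation "g' \<equiv> deriv_Icc A B g"

lemma p_cont: "continuous_on {A..B} p" and r_cont: "continuous_on {A..B} r"
  using p_diff r_diff by (auto intro: differentiable_imp_continuous_on)

lemma g_cont: "continuous_on {A..B} g"
  using g_sol by (auto simp: sl_solution_def intro: differentiable_imp_continuous_on)

text \<open>A solution gives differentiability of p g' only; continuity of g' follows on dividing by
  p > 0.\<close>

lemma g'_cont: "continuous_on {A..B} g'"
proof -
  have "continuous_on {A..B} (\<lambda>s. of_real (p s) * g' s)"
    using g_sol by (auto simp: sl_solution_def intro: differentiable_imp_continuous_on)
  then have "continuous_on {A..B} (\<lambda>s. (of_real (p s) * g' s) / of_real (p s))"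
    by (rule continuous_on_divide[OF _ continuous_on_of_real[OF p_cont]]) (use p_pos in force)
  then show ?thesis
    by (rule continuous_on_eq) (use p_pos in force)
qed

lemma rho_pos: "y \<in> {A..B} \<Longrightarrow> \<rho> y > 0"
  using p_pos[of y] r_pos[of y] by (simp add: sl_rho_def)

lemma rho_squared: "y \<in> {A..B} \<Longrightarrow> (\<rho> y)\<^sup>2 = sqrt (p y * r y)"
  using p_pos[of y] r_pos[of y]
  by (simp add: sl_rho_def powr_half_sqrt[symmetric] powr_powr flip: powr_numeral)

lemma rho_cont: "continuous_on {A..B} \<rho>"
proof -
  have "continuous_on {A..B} (\<lambda>y. (p y * r y) powr (1 / 4))"
    by (intro continuous_intros p_cont r_cont) (use p_pos r_pos in force)
  then show ?thesis by (simp add: sl_rho_def [abs_def])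
qed

lemma rho'_eq:
  assumes y: "y \<in> {A..B}"
  shows "\<rho>' y = 1 / 4 * (p y * r y) powr (1 / 4 - 1) * (p y * deriv_Icc A B r y + deriv_Icc A B p y * r y)"
proof -
  have pd: "(p has_vector_derivative deriv_Icc A B p y) (at y within {A..B})"
    using p_diff y by (simp add: differentiable_on_def vector_derivative_works)
  have rd: "(r has_vector_derivative deriv_Icc A B r y) (at y within {A..B})"
    using r_diff y by (simp add: differentiable_on_def vector_derivative_works)
  have d1: "((\<lambda>s. p s * r s) has_field_derivative (p y * deriv_Icc A B r y + deriv_Icc A B p y * r y)) (at y within {A..B})"
    using has_vector_derivative_mult[OF pd rd] by (simp add: has_real_derivative_iff_has_vector_derivative)
  have d2: "((\<lambda>t. t powr (1 / 4)) has_field_derivative 1 / 4 * (p y * r y) powr (1 / 4 - 1)) (at (p y * r y))"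
    using p_pos[OF y] r_pos[OF y] by (intro has_real_derivative_powr) simp
  have "((\<lambda>s. (p s * r s) powr (1 / 4)) has_field_derivative
      1 / 4 * (p y * r y) powr (1 / 4 - 1) * (p y * deriv_Icc A B r y + deriv_Icc A B p y * r y)) (at y within {A..B})"
    by (rule DERIV_chain2[OF d2 d1])
  then have "(\<rho> has_vector_derivative
      1 / 4 * (p y * r y) powr (1 / 4 - 1) * (p y * deriv_Icc A B r y + deriv_Icc A B p y * r y)) (at y within {A..B})"
    by (simp add: sl_rho_def [abs_def] has_real_derivative_iff_has_vector_derivative)
  then show ?thesis
    using AB y by (intro vector_derivative_within_closed_interval) auto
qed

lemma rho'_cont: "continuous_on {A..B} \<rho>'"
proof -
  have "continuous_on {A..B} (\<lambda>y. 1 / 4 * (p y * r y) powr (1 / 4 - 1) * (p y * deriv_Icc A B r y + deriv_Icc A B p y * r y))"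
    by (intro continuous_intros p_cont r_cont p'_cont r'_cont) (use p_pos r_pos in force)
  then show ?thesis by (rule continuous_on_eq) (simp add: rho'_eq)
qed

abbreviation "w \<equiv> (\<lambda>P s. if P then 1 / ((g s)\<^sup>2 * of_real (p s)) else (g s)\<^sup>2 * of_real (r s))"

lemma w_cont: "continuous_on {A..B} (w P)"
proof (cases P)
  case True
  have "continuous_on {A..B} (\<lambda>s. 1 / ((g s)\<^sup>2 * of_real (p s)))"
    by (intro continuous_intros g_cont p_cont) (use p_pos g_nz in force)
  then show ?thesis using True by simp
next
  case False
  have "continuous_on {A..B} (\<lambda>s. (g s)\<^sup>2 * of_real (r s))"
    by (intro continuous_intros g_cont r_cont)
  then show ?thesis using False by simp
qed

text \<open>Both families use the pair of weights \<open>w\<close>; for the plain powers the order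
  is reversed, which the negation in the second instance expresses.\<close>

sublocale Yt: iterated_integrals A B w "formal_Yt A p r g"
  by unfold_locales (use w_cont in simp_all)

sublocale Y: iterated_integrals A B "\<lambda>P. w (\<not> P)" "formal_Y A p r g"
  by unfold_locales (use w_cont in simp_all)

abbreviation "\<Phi> \<equiv> sl_Phi A p r g"
abbreviation "\<Psi> \<equiv> sl_Psi A p r g"

text \<open>Polya factorisation: because g solves the equation with \<omega> = 0, the operator (p
  v')' - q v equals (p g^2 (v/g)')' / g and q disappears. Up to 1/\<omega>, F is p g^2 f', and this
  scaling gives both equations the same factor \<omega> up to sign.\<close>

lemma solution_quotient:
  assumes v: "sl_solution A B p q r (\<omega>\<^sup>2) v" and \<omega>: "\<omega> \<noteq> 0"
  defines "f \<equiv> \<lambda>s. v s / g s"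
    and "F \<equiv> \<lambda>s. (of_real (p s) * deriv_Icc A B v s * g s - v s * (of_real (p s) * g' s)) / \<omega>"
  assumes y: "y \<in> {A..B}"
  shows "(f has_vector_derivative (\<omega> * (w True y * F y))) (at y within {A..B})"
    and "(F has_vector_derivative (- \<omega> * (w False y * f y))) (at y within {A..B})"
proof -
  note v' = sl_solutionD[OF v y] and g'' = sl_solutionD[OF g_sol y]
  have nz: "g y \<noteq> 0" "p y \<noteq> 0" using g_nz[OF y] p_pos[OF y] by auto
  have "((\<lambda>s. inverse (g s)) has_vector_derivative g' y * - (inverse (g y) ^ Suc (Suc 0))) (at y within {A..B})"
    using field_vector_diff_chain_within[OF g''(1) DERIV_inverse[OF nz(1)]] by (simp only: o_def)
  from has_vector_derivative_mult[OF v'(1) this]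
  have "(f has_vector_derivative (v y * (g' y * - (inverse (g y) ^ Suc (Suc 0))) + deriv_Icc A B v y * inverse (g y))) (at y within {A..B})"
    by (simp add: f_def divide_inverse)
  moreover have "v y * (g' y * - (inverse (g y) ^ Suc (Suc 0))) + deriv_Icc A B v y * inverse (g y)
      = \<omega> * (w True y * F y)"
    using nz \<omega> by (simp add: F_def field_simps power2_eq_square)
  ultimately show "(f has_vector_derivative (\<omega> * (w True y * F y))) (at y within {A..B})" by simp
  have "(F has_vector_derivative
      ((of_real (p y) * deriv_Icc A B v y * g' y + (q y * v y - \<omega>\<^sup>2 * of_real (r y) * v y) * g y)
        - (v y * (q y * g y - 0 * of_real (r y) * g y) + deriv_Icc A B v y * (of_real (p y) * g' y))) / \<omega>)
      (at y within {A..B})"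
    unfolding F_def
    by (intro has_vector_derivative_divide has_vector_derivative_diff has_vector_derivative_mult v' g'')
  moreover have "((of_real (p y) * deriv_Icc A B v y * g' y + (q y * v y - \<omega>\<^sup>2 * of_real (r y) * v y) * g y)
        - (v y * (q y * g y - 0 * of_real (r y) * g y) + deriv_Icc A B v y * (of_real (p y) * g' y))) / \<omega>
      = - \<omega> * (w False y * f y)"
    using nz \<omega> by (simp add: f_def field_simps power2_eq_square)
  ultimately show "(F has_vector_derivative (- \<omega> * (w False y * f y))) (at y within {A..B})" by simp
qed

text \<open>The summand for \<open>k\<close> in the definition of \<open>\<mu>\<^sub>n\<close>, without the factor \<open>l\<^sub>k\<^sub>,\<^sub>n / l\<^sup>k\<close>.\<close>

definition moment :: "real \<Rightarrow> nat \<Rightarrow> complex" where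
  "moment y k = of_nat k * (\<Psi> (k - 1) y / of_real (\<rho> y))
     + of_real (\<rho> y * sqrt (p y / r y)) * (g' y / g y + of_real (\<rho>' y / \<rho> y)) * \<Phi> k y"

lemma norm_moment_le:
  assumes y: "y \<in> {A..B}"
  shows "\<exists>C L. L \<ge> 1 \<and> (\<forall>k. norm (moment y k) \<le> C * L ^ k)"
proof -
  obtain K1 where K1: "\<forall>P. \<forall>s\<in>{A..B}. norm (w P s) \<le> K1"
    using bounded_family_Icc[where F = w, OF w_cont] by metis
  then have Yt: "norm (formal_Yt A p r g n y) \<le> (K1 * (y - A)) ^ n" for n
    by (intro Yt.norm_X_le y) simp
  from K1 have Y: "norm (formal_Y A p r g n y) \<le> (K1 * (y - A)) ^ n" for n
    by (intro Y.norm_X_le y) simp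
  \<comment> \<open>The lower bound 1 makes the powers of L increasing, so that L^(k-1) may be
    replaced by L^k.\<close>
  define L where "L = max 1 (\<bar>K1 * (y - A)\<bar>)"
  have L: "L \<ge> 1" by (simp add: L_def)
  have le: "(K1 * (y - A)) ^ n \<le> L ^ n" for n
  proof -
    have "(K1 * (y - A)) ^ n \<le> \<bar>K1 * (y - A)\<bar> ^ n"
      using abs_ge_self[of "(K1 * (y - A)) ^ n"] by (simp only: power_abs)
    also have "\<dots> \<le> L ^ n" by (intro power_mono) (simp_all add: L_def)
    finally show ?thesis .
  qed
  have \<Phi>: "norm (\<Phi> k y) \<le> norm (g y) * L ^ k" for k
    using order_trans[OF Yt le] order_trans[OF Y le] by (auto simp: sl_Phi_def norm_mult intro!: mult_left_mono)
  have \<Psi>: "norm (\<Psi> k y) \<le> norm (1 / g y) * L ^ k" for k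
    unfolding sl_Psi_def using order_trans[OF Yt le] order_trans[OF Y le]
    by (auto simp only: norm_mult intro!: mult_left_mono norm_ge_zero split: if_splits)
  let ?\<beta> = "of_real (\<rho> y * sqrt (p y / r y)) * (g' y / g y + of_real (\<rho>' y / \<rho> y)) :: complex"
  \<comment> \<open>The base is doubled because 2^k absorbs the factor k.\<close>
  have "norm (moment y k) \<le> (norm (1 / g y) / \<rho> y + norm ?\<beta> * norm (g y)) * (2 * L) ^ k" for k
  proof -
    have k: "real k \<le> 2 ^ k" using of_nat_mono[OF less_imp_le[OF less_exp[of k]]] by simp
    have "norm (of_nat k * (\<Psi> (k - 1) y / of_real (\<rho> y))) = real k * (norm (\<Psi> (k - 1) y) / \<rho> y)"
      using rho_pos[OF y] by (simp add: norm_mult norm_divide)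
    also have "\<dots> \<le> 2 ^ k * (norm (1 / g y) * L ^ k / \<rho> y)"
    proof (intro mult_mono divide_right_mono k)
      have "norm (1 / g y) * L ^ (k - 1) \<le> norm (1 / g y) * L ^ k"
        by (intro mult_left_mono power_increasing L) auto
      then show "norm (\<Psi> (k - 1) y) \<le> norm (1 / g y) * L ^ k" using \<Psi>[of "k - 1"] by linarith
    qed (use rho_pos[OF y] in auto)
    finally have 1: "norm (of_nat k * (\<Psi> (k - 1) y / of_real (\<rho> y))) \<le> norm (1 / g y) / \<rho> y * (2 * L) ^ k"
      by (simp add: power_mult_distrib mult_ac)
    have "norm (?\<beta> * \<Phi> k y) \<le> norm ?\<beta> * (norm (g y) * L ^ k)"
      unfolding norm_mult[of ?\<beta>] by (intro mult_left_mono \<Phi>) auto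
    also have "\<dots> \<le> norm ?\<beta> * (norm (g y) * (2 * L) ^ k)"
      using L by (intro mult_left_mono power_mono) auto
    finally have 2: "norm (?\<beta> * \<Phi> k y) \<le> norm ?\<beta> * norm (g y) * (2 * L) ^ k" by (simp only: mult.assoc)
    show ?thesis unfolding moment_def
      using norm_triangle_mono[OF 1 2] by (simp only: distrib_right)
  qed
  moreover have "2 * L \<ge> 1" using L by simp
  ultimately show ?thesis by blast
qed

text \<open>The computation common to both solutions, with \<kappa> = 1 for v1 and \<kappa> = i for
  v2. After an index shift the \<Psi> terms sum to \<kappa> (p/\<rho>)(v' - v g'/g); the \<Phi>
  terms sum to \<kappa> (p/\<rho>)(g'/g + \<rho>'/\<rho>) v, since \<rho> sqrt(p/r) = p/\<rho>. The
  terms with g'/g cancel.\<close>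

lemma moment_series:
  assumes y: "y \<in> {A..B}" and \<omega>: "\<omega> \<noteq> 0"
    and \<Phi>: "\<And>k. even k = P \<Longrightarrow> \<Phi> k y = g y * X k" and \<Psi>: "\<And>k. even k = (\<not> P) \<Longrightarrow> \<Psi> k y = X k / g y"
    and U1: "(\<lambda>k. if even k = P then (\<i> * \<omega>) ^ k * X k / fact k else 0) sums (\<kappa> * (v / g y))"
    and U2: "(\<lambda>k. if even k = (\<not> P) then (\<i> * \<omega>) ^ k * X k / fact k else 0) sums
      (- \<i> * \<kappa> * ((of_real (p y) * v' * g y - v * (of_real (p y) * g' y)) / \<omega>))"
  shows "(\<lambda>k. if even k = P then (\<i> * \<omega>) ^ k * moment y k / fact k else 0) sums
     (\<kappa> * (of_real (\<rho> y * sqrt (p y / r y)) * (v' + of_real (\<rho>' y / \<rho> y) * v)))"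
proof -
  let ?\<beta> = "of_real (\<rho> y * sqrt (p y / r y)) * (g' y / g y + of_real (\<rho>' y / \<rho> y)) :: complex"
  let ?h = "\<lambda>k. \<i> * \<omega> / (g y * of_real (\<rho> y)) * ((\<i> * \<omega>) ^ k * X k / fact k)"
  let ?F = "(of_real (p y) * v' * g y - v * (of_real (p y) * g' y)) / \<omega>"
  have nz: "g y \<noteq> 0" "p y > 0" "r y > 0" "\<rho> y > 0"
    using g_nz[OF y] p_pos[OF y] r_pos[OF y] rho_pos[OF y] by auto
  have 1: "(\<lambda>k. if even k = P then (\<i> * \<omega>) ^ k * (of_nat k * (\<Psi> (k - 1) y / of_real (\<rho> y))) / fact k else 0) sums
     (\<i> * \<omega> / (g y * of_real (\<rho> y)) * (- \<i> * \<kappa> * ?F))"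
  proof (rule sums_shift_parity)
    have "(\<lambda>k. \<i> * \<omega> / (g y * of_real (\<rho> y)) * (if even k = (\<not> P) then (\<i> * \<omega>) ^ k * X k / fact k else 0)) sums
       (\<i> * \<omega> / (g y * of_real (\<rho> y)) * (- \<i> * \<kappa> * ?F))"
      by (rule sums_mult[OF U2])
    also have "(\<lambda>k. \<i> * \<omega> / (g y * of_real (\<rho> y)) * (if even k = (\<not> P) then (\<i> * \<omega>) ^ k * X k / fact k else 0))
      = (\<lambda>k. if even k = (\<not> P) then ?h k else 0)" by auto
    finally show "(\<lambda>k. if even k = (\<not> P) then ?h k else 0) sums
       (\<i> * \<omega> / (g y * of_real (\<rho> y)) * (- \<i> * \<kappa> * ?F))" .
    show "(\<i> * \<omega>) ^ Suc k * (of_nat (Suc k) * (\<Psi> (Suc k - 1) y / of_real (\<rho> y))) / fact (Suc k) = ?h k"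
      if "even k = (\<not> P)" for k
    proof -
      have "a * b * (c * (x / g y / s)) / (c * d) = a / (g y * s) * (b * x / d)"
        if "c \<noteq> 0" for a b c x s d :: complex
        using that by simp
      from this[of "of_nat (Suc k)"] show ?thesis
        unfolding fact_Suc power_Suc diff_Suc_1 \<Psi>[OF that] by (simp only: of_nat_neq_0 not_False_eq_True)
    qed
  qed simp
  have 2: "(\<lambda>k. ?\<beta> * g y * (if even k = P then (\<i> * \<omega>) ^ k * X k / fact k else 0)) sums (?\<beta> * g y * (\<kappa> * (v / g y)))"
    by (rule sums_mult[OF U1])
  have "(\<lambda>k. if even k = P then (\<i> * \<omega>) ^ k * moment y k / fact k else 0) =
     (\<lambda>k. (if even k = P then (\<i> * \<omega>) ^ k * (of_nat k * (\<Psi> (k - 1) y / of_real (\<rho> y))) / fact k else 0)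
        + ?\<beta> * g y * (if even k = P then (\<i> * \<omega>) ^ k * X k / fact k else 0))"
    by (auto simp: moment_def \<Phi> distrib_left distrib_right add_divide_distrib mult_ac)
  moreover have "\<i> * \<omega> / (g y * of_real (\<rho> y)) * (- \<i> * \<kappa> * ?F) + ?\<beta> * g y * (\<kappa> * (v / g y)) =
      \<kappa> * (of_real (\<rho> y * sqrt (p y / r y)) * (v' + of_real (\<rho>' y / \<rho> y) * v))"
  proof -
    have "p y / \<rho> y = \<rho> y * sqrt (p y / r y)"
    proof -
      have "\<rho> y * (\<rho> y * sqrt (p y / r y)) = sqrt (p y * r y) * sqrt (p y / r y)"
        using rho_squared[OF y] by (simp add: power2_eq_square mult_ac)
      also have "\<dots> = sqrt (p y * p y)"
        using nz by (simp flip: real_sqrt_mult)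
      also have "\<dots> = p y" using nz by simp
      finally show ?thesis using nz by (simp add: field_simps)
    qed
    then have *: "complex_of_real (\<rho> y * sqrt (p y / r y)) = of_real (p y) / of_real (\<rho> y)"
      by (simp flip: of_real_divide)
    have "\<i> * \<omega> / (g y * of_real (\<rho> y)) * (- \<i> * \<kappa> * ?F) =
        - (\<i> * \<i>) * (\<kappa> * (of_real (p y) * v' * g y - v * (of_real (p y) * g' y)) / (g y * of_real (\<rho> y)))"
      using \<omega> by simp
    also have "\<dots> = \<kappa> * (of_real (p y) / of_real (\<rho> y) * (v' - v * g' y / g y))"
      using nz by (simp add: field_simps)
    finally show ?thesis unfolding * using nz by (simp add: algebra_simps add_divide_distrib)
  qed
  ultimately show ?thesis using sums_add[OF 1 2] by (simp only:)
qed

lemma moment_series_1: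
  assumes v: "sl_solution A B p q r (\<omega>\<^sup>2) v" and \<omega>: "\<omega> \<noteq> 0"
    and v_A: "v A = of_real (1 / \<rho> A)" and v'_A: "deriv_Icc A B v A = g' A"
    and y: "y \<in> {A..B}"
  shows "(\<lambda>k. if even k = True then (\<i> * \<omega>) ^ k * moment y k / fact k else 0) sums
     (1 * (of_real (\<rho> y * sqrt (p y / r y)) * (deriv_Icc A B v y + of_real (\<rho>' y / \<rho> y) * v y)))"
proof -
  define f where "f = (\<lambda>s. v s / g s)"
  define F where "F = (\<lambda>s. (of_real (p s) * deriv_Icc A B v s * g s - v s * (of_real (p s) * g' s)) / \<omega>)"
  \<comment> \<open>The factor -i gives both equations the constant i \<omega>. Equal data of v and
    g at A make f(A) = 1 and F(A) = 0, so f is the even component.\<close>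
  define U where "U = (\<lambda>P. if P then f else (\<lambda>s. - \<i> * F s))"
  have A: "A \<in> {A..B}" using AB by simp
  have f': "(f has_vector_derivative (\<omega> * (w True s * F s))) (at s within {A..B})"
      "(F has_vector_derivative (- \<omega> * (w False s * f s))) (at s within {A..B})"
    if "s \<in> {A..B}" for s
    using solution_quotient[OF v \<omega> that] unfolding f_def F_def by simp_all
  have U: "U True = f" "U False = (\<lambda>s. - \<i> * F s)" by (simp_all add: U_def)
  have U_deriv: "(U P has_vector_derivative \<i> * \<omega> * (w P s * U (\<not> P) s)) (at s within {A..B})"
    if s: "s \<in> {A..B}" for P s
  proof (cases "P = True")
    case True
    have "\<omega> * (a * b) = \<i> * \<omega> * (a * (- \<i> * b))" for a b
    proof -
      have "\<omega> * (a * b) = - (\<i> * \<i>) * (\<omega> * (a * b))" by simp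
      also have "\<dots> = \<i> * \<omega> * (a * (- \<i> * b))" by algebra
      finally show ?thesis .
    qed
    with f'(1)[OF s] show ?thesis unfolding True not_True_eq_False U by (simp only:)
  next
    case False
    then have P: "P = False" by simp
    have "(U False has_vector_derivative (- \<i> * (- \<omega> * (w False s * f s)))) (at s within {A..B})"
      unfolding U by (rule has_vector_derivative_mult_right[OF f'(2)[OF s]])
    moreover have "- \<i> * (- \<omega> * (a * b)) = \<i> * \<omega> * (a * b)" for a b by simp
    ultimately show ?thesis unfolding P not_False_eq_True U by (simp only:)
  qed
  have U_A: "U P A = of_bool P" for P
    using g_A v_A v'_A rho_pos[OF A] by (cases P) (simp_all add: U f_def F_def)
  have series: "(\<lambda>k. if even k = P then (\<i> * \<omega>) ^ k * formal_Yt A p r g k y / fact k else 0) sums U P y" for P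
    by (rule Yt.spectral_power_series[where U = U, OF U_deriv U_A y])
  show ?thesis
  proof (rule moment_series[OF y \<omega>, where X = "\<lambda>k. formal_Yt A p r g k y"])
    show "(\<lambda>k. if even k = True then (\<i> * \<omega>) ^ k * formal_Yt A p r g k y / fact k else 0) sums (1 * (v y / g y))"
      using series[of True] by (simp add: U f_def F_def)
    show "(\<lambda>k. if even k = (\<not> True) then (\<i> * \<omega>) ^ k * formal_Yt A p r g k y / fact k else 0) sums (- \<i> * 1 * ((of_real (p y) * deriv_Icc A B v y * g y - v y * (of_real (p y) * g' y)) / \<omega>))"
      using series[of False] by (simp add: U f_def F_def)
  qed (auto simp: sl_Phi_def sl_Psi_def)
qed

lemma moment_series_2:
  assumes v: "sl_solution A B p q r (\<omega>\<^sup>2) v" and \<omega>: "\<omega> \<noteq> 0"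
    and v_A: "v A = 0" and v'_A: "deriv_Icc A B v A = \<omega> / of_real (\<rho> A) * of_real (sqrt (r A / p A))"
    and y: "y \<in> {A..B}"
  shows "(\<lambda>k. if even k = False then (\<i> * \<omega>) ^ k * moment y k / fact k else 0) sums
     (\<i> * (of_real (\<rho> y * sqrt (p y / r y)) * (deriv_Icc A B v y + of_real (\<rho>' y / \<rho> y) * v y)))"
proof -
  define f where "f = (\<lambda>s. v s / g s)"
  define F where "F = (\<lambda>s. (of_real (p s) * deriv_Icc A B v s * g s - v s * (of_real (p s) * g' s)) / \<omega>)"
  \<comment> \<open>The roles are exchanged: F(A) = 1 and f(A) = 0, so F is the even component. The
    weights change places with it, which leads to the plain powers.\<close>
  define U where "U = (\<lambda>P. if P then F else (\<lambda>s. \<i> * f s))"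
  have A: "A \<in> {A..B}" using AB by simp
  have f': "(f has_vector_derivative (\<omega> * (w True s * F s))) (at s within {A..B})"
      "(F has_vector_derivative (- \<omega> * (w False s * f s))) (at s within {A..B})"
    if "s \<in> {A..B}" for s
    using solution_quotient[OF v \<omega> that] unfolding f_def F_def by simp_all
  have U: "U True = F" "U False = (\<lambda>s. \<i> * f s)" by (simp_all add: U_def)
  have U_deriv: "(U P has_vector_derivative \<i> * \<omega> * (w (\<not> P) s * U (\<not> P) s)) (at s within {A..B})"
    if s: "s \<in> {A..B}" for P s
  proof (cases "P = True")
    case True
    have "- \<omega> * (a * b) = \<i> * \<omega> * (a * (\<i> * b))" for a b
    proof -
      have "- \<omega> * (a * b) = (\<i> * \<i>) * (\<omega> * (a * b))" by simp
      also have "\<dots> = \<i> * \<omega> * (a * (\<i> * b))" by algebra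
      finally show ?thesis .
    qed
    with f'(2)[OF s] show ?thesis unfolding True not_True_eq_False U by (simp only:)
  next
    case False
    then have P: "P = False" by simp
    have "(U False has_vector_derivative (\<i> * (\<omega> * (w True s * F s)))) (at s within {A..B})"
      unfolding U by (rule has_vector_derivative_mult_right[OF f'(1)[OF s]])
    moreover have "\<i> * (\<omega> * (a * b)) = \<i> * \<omega> * (a * b)" for a b by simp
    ultimately show ?thesis unfolding P not_False_eq_True U by (simp only:)
  qed
  have U_A: "U P A = of_bool P" for P
  proof (cases P)
    case True
    \<comment> \<open>The initial slope of v2 is normalised so that F(A) = p(A) sqrt(r(A)/p(A)) /
      \<rho>(A)^2 = 1.\<close>
    have "(\<rho> A)\<^sup>2 = sqrt (p A * r A)" by (rule rho_squared[OF A])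
    also have "\<dots> = p A * sqrt (r A / p A)"
      using p_pos[OF A] r_pos[OF A] by (simp add: real_sqrt_mult real_sqrt_divide field_simps)
    finally have *: "p A * sqrt (r A / p A) = (\<rho> A)\<^sup>2" ..
    have "p A * sqrt (r A / p A) / (\<rho> A * \<rho> A) = 1"
      unfolding * using rho_pos[OF A] by (simp add: power2_eq_square)
    then have "complex_of_real (p A * sqrt (r A / p A) / (\<rho> A * \<rho> A)) = 1"
      by (simp only: of_real_1)
    then have "of_real (p A) * of_real (sqrt (r A / p A)) / (of_real (\<rho> A) * of_real (\<rho> A)) = (1 :: complex)"
      by (simp only: of_real_mult of_real_divide)
    moreover have "F A = of_real (p A) * of_real (sqrt (r A / p A)) / (of_real (\<rho> A) * of_real (\<rho> A)) * (\<omega> / \<omega>)"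
      unfolding F_def v_A v'_A g_A by simp
    ultimately show ?thesis using True \<omega> by (simp add: U)
  qed (simp add: U f_def v_A)
  have series: "(\<lambda>k. if even k = P then (\<i> * \<omega>) ^ k * formal_Y A p r g k y / fact k else 0) sums U P y" for P
    by (rule Y.spectral_power_series[where U = U, OF U_deriv U_A y])
  show ?thesis
  proof (rule moment_series[OF y \<omega>, where X = "\<lambda>k. formal_Y A p r g k y"])
    show "(\<lambda>k. if even k = False then (\<i> * \<omega>) ^ k * formal_Y A p r g k y / fact k else 0) sums (\<i> * (v y / g y))"
      using series[of False] by (simp add: U f_def F_def)
    show "(\<lambda>k. if even k = (\<not> False) then (\<i> * \<omega>) ^ k * formal_Y A p r g k y / fact k else 0) sums (- \<i> * \<i> * ((of_real (p y) * deriv_Icc A B v y * g y - v y * (of_real (p y) * g' y)) / \<omega>))"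
      using series[of True] by (simp add: U f_def F_def)
  qed (auto simp: sl_Phi_def sl_Psi_def)
qed

end

section \<open>The functions mu_n and the two representations\<close>

context sl_problem
begin

abbreviation "l \<equiv> sl_l A p r"
abbreviation "h \<equiv> sl_h A B p r g"
abbreviation "G1 \<equiv> sl_G1 A B p q r g"
abbreviation "G2 \<equiv> sl_G2 A B p q r g"
abbreviation "\<mu> \<equiv> sl_mu A B p q r g"

lemma l_pos:
  assumes y: "y \<in> {A<..B}"
  shows "l y > 0"
proof -
  have cont: "continuous_on {A..y} (\<lambda>s. sqrt (r s / p s))"
    using y p_pos by (intro continuous_intros continuous_on_subset[OF p_cont] continuous_on_subset[OF r_cont]) force+
  have pos: "sqrt (r s / p s) > 0" if "s \<in> {A..y}" for s
    using p_pos[of s] r_pos[of s] that y by simp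
  obtain s where s: "s \<in> {A..y}" and min: "\<And>t. t \<in> {A..y} \<Longrightarrow> sqrt (r s / p s) \<le> sqrt (r t / p t)"
    using continuous_attains_inf[OF compact_Icc _ cont] y by force
  have "0 < sqrt (r s / p s) * (y - A)" using pos[OF s] y by (intro mult_pos_pos) auto
  also have "\<dots> = integral {A..y} (\<lambda>_. sqrt (r s / p s))" using y by (simp add: mult.commute)
  also have "\<dots> \<le> integral {A..y} (\<lambda>t. sqrt (r t / p t))"
    by (intro integral_le integrable_continuous_interval cont continuous_on_const min)
  finally show ?thesis by (simp add: sl_l_def)
qed

text \<open>The last two terms of mu_n merge into a single constant of the bracket, equal to G1 for
  even n and to G2 for odd n.\<close>

lemma mu_eq:
  assumes "y \<in> {A<..B}"
  shows "\<mu> n y = of_real ((2 * real n + 1) / (2 * \<rho> y)) *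
    mu_bracket (moment y) (l y) (G2 y + h / 2 * (1 + (-1) ^ n)) n"
proof -
  have "legendre_apply (\<lambda>k. moment y k / of_real (l y) ^ k) n =
      (\<Sum>k\<le>n. of_real (coeff (legendre_poly n) k / l y ^ k) * moment y k)"
    unfolding legendre_apply_def by (intro sum.cong refl) simp
  moreover have "(y = A) = False" using assms by simp
  ultimately show ?thesis
    unfolding sl_mu_def sl_mu_formula_def mu_bracket_def
    by (simp only: if_False moment_def diff_diff_eq add.assoc)
qed

lemma G2_cont: "continuous_on {A..B} G2"
proof -
  have "continuous_on {A..B} (\<lambda>s. q s / of_real ((\<rho> s)\<^sup>2) + of_real ((\<rho>' s)\<^sup>2 / r s))"
    using rho_pos r_pos by (intro continuous_intros q_cont rho_cont rho'_cont r_cont) force+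
  then have "continuous_on {A..B} (\<lambda>y. integral {A..y} (\<lambda>s. q s / of_real ((\<rho> s)\<^sup>2) + of_real ((\<rho>' s)\<^sup>2 / r s)))"
    by (intro indefinite_integral_continuous_1 integrable_continuous_interval)
  then have "continuous_on {A..B} (\<lambda>y. h + of_real (\<rho> y * \<rho>' y / (2 * r y)) - of_real (\<rho> A * \<rho>' A / (2 * r A))
     + 1 / 2 * integral {A..y} (\<lambda>s. q s / of_real ((\<rho> s)\<^sup>2) + of_real ((\<rho>' s)\<^sup>2 / r s)) - h)"
    using r_pos by (intro continuous_intros rho_cont rho'_cont r_cont) force+
  then show ?thesis by (simp only: sl_G2_def [abs_def] sl_G1_def)
qed

lemma G2_A: "G2 A = 0"
  by (simp add: sl_G2_def sl_G1_def)

text \<open>For n = 0 nothing is divided by l, so the formula is continuous up to A and the limit is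
  its value there. Because \<rho>(A) g(A) = 1, the \<Phi>_0 term equals h; G2(A) = 0, and the last
  term subtracts h again.\<close>

lemma mu_0_A: "\<mu> 0 A = 0"
proof -
  let ?f = "\<lambda>y. of_real (1 / (2 * \<rho> y)) *
      (of_real (\<rho> y * sqrt (p y / r y)) * (g' y / g y + of_real (\<rho>' y / \<rho> y)) * g y - G2 y - h)"
  have A: "A \<in> {A..B}" using AB by simp
  have f: "sl_mu_formula A B p q r g 0 = ?f"
    by (rule ext) (simp add: sl_mu_formula_def legendre_poly_0 sl_Phi_def)
  have "continuous_on {A..B} ?f"
    using rho_pos r_pos g_nz
    by (intro continuous_intros rho_cont rho'_cont g_cont g'_cont p_cont r_cont G2_cont) force+
  then have "(?f \<longlongrightarrow> ?f A) (at A within {A..B})"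
    using A by (simp add: continuous_on_def)
  moreover have "?f A = 0"
    using g_A rho_pos[OF A] by (simp add: G2_A sl_h_def)
  moreover have "at A within {A..B} \<noteq> bot"
    using AB by (simp add: at_within_Icc_at_right)
  ultimately have "Lim (at A within {A..B}) ?f = 0" by (intro tendsto_Lim) (simp_all only: not_False_eq_True)
  then show ?thesis by (simp add: sl_mu_def f)
qed

lemma rho_sqrt_cancel:
  assumes y: "y \<in> {A..B}"
  shows "of_real (sqrt (r y / p y)) * (1 / of_real (\<rho> y) * (of_real (\<rho> y * sqrt (p y / r y)) * (c::complex))) = c"
proof -
  have "sqrt (r y / p y) * sqrt (p y / r y) = 1"
    using p_pos[OF y] r_pos[OF y] by (simp flip: real_sqrt_mult)
  then have *: "complex_of_real (sqrt (r y / p y)) * of_real (sqrt (p y / r y)) = 1"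
    by (simp flip: of_real_mult)
  have "of_real (sqrt (r y / p y)) * (1 / of_real (\<rho> y) * (of_real (\<rho> y * sqrt (p y / r y)) * c)) =
     (of_real (sqrt (r y / p y)) * of_real (sqrt (p y / r y))) * c"
    using rho_pos[OF y] by simp
  then show ?thesis unfolding * by simp
qed

lemma representation_1:
  assumes v: "sl_solution A B p q r (\<omega>\<^sup>2) v" and \<omega>: "\<omega> \<noteq> 0"
    and v_A: "v A = of_real (1 / \<rho> A)" and v'_A: "deriv_Icc A B v A = g' A"
    and y: "y \<in> {A..B}"
  defines "a \<equiv> \<lambda>n. (-1) ^ n * \<mu> (2 * n) y * sph_bessel_j (2 * n) (\<omega> * of_real (l y))"
  shows "summable a \<and> deriv_Icc A B v y =
      of_real (sqrt (r y / p y)) *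
        (1 / of_real (\<rho> y) * (G1 y * cos (\<omega> * of_real (l y)) - \<omega> * sin (\<omega> * of_real (l y)))
          + 2 * (\<Sum>n. a n))
      - of_real (\<rho>' y / \<rho> y) * v y"
proof (cases "y = A")
  case True
  have A: "A \<in> {A..B}" using AB by simp
  have l: "l A = 0" by (simp add: sl_l_def)
  have "a n = 0" for n
    by (cases "n = 0") (simp_all add: a_def True mu_0_A l sph_bessel_j_0_right)
  then have a: "a = (\<lambda>_. 0)" by (rule ext)
  have "G1 A = h" using G2_A by (simp add: sl_G2_def)
  moreover have "of_real (sqrt (r A / p A)) * (1 / of_real (\<rho> A) * h) =
    g' A + of_real (\<rho>' A / \<rho> A) * v A"
  proof -
    \<comment> \<open>Both g(A) and v(A) are 1/\<rho>(A), which turns the logarithmic derivatives in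
      h into g' and (\<rho>'/\<rho>) v.\<close>
    have "h = of_real (\<rho> A * sqrt (p A / r A)) * (g' A + of_real (\<rho>' A / \<rho> A) * v A)"
      using rho_pos[OF A] by (simp add: sl_h_def g_A v_A algebra_simps)
    then show ?thesis by (simp only: rho_sqrt_cancel[OF A])
  qed
  ultimately show ?thesis unfolding a True l using v'_A by simp
next
  case False
  then have y': "y \<in> {A<..B}" using y by simp
  let ?z = "\<omega> * of_real (l y)"
  let ?D = "of_real (\<rho> y * sqrt (p y / r y)) * (deriv_Icc A B v y + of_real (\<rho>' y / \<rho> y) * v y)"
  obtain C L where L: "L \<ge> 1" and d: "\<And>k. norm (moment y k) \<le> C * L ^ k"
    using norm_moment_le[OF y] by blast
  have "(\<lambda>n. (2 * of_nat (2 * n) + 1) * ((-1) ^ n * sph_bessel_j (2 * n) ?z * mu_bracket (moment y) (l y) (G1 y) (2 * n)))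
      sums (1 * ?D + \<omega> * sin ?z - G1 y * cos ?z)"
    by (rule neumann_mu_bracket(1)[OF d L l_pos[OF y'] moment_series_1[OF v \<omega> v_A v'_A y] TrueI])
  then have "(\<lambda>n. 1 / (2 * of_real (\<rho> y)) * ((2 * of_nat (2 * n) + 1) * ((-1) ^ n * sph_bessel_j (2 * n) ?z * mu_bracket (moment y) (l y) (G1 y) (2 * n))))
      sums (1 / (2 * of_real (\<rho> y)) * (1 * ?D + \<omega> * sin ?z - G1 y * cos ?z))"
    by (rule sums_mult)
  moreover have "a = (\<lambda>n. 1 / (2 * of_real (\<rho> y)) * ((2 * of_nat (2 * n) + 1) * ((-1) ^ n * sph_bessel_j (2 * n) ?z * mu_bracket (moment y) (l y) (G1 y) (2 * n))))"
    by (rule ext) (simp add: a_def mu_eq[OF y'] sl_G2_def)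
  ultimately have a: "a sums (1 / (2 * of_real (\<rho> y)) * (?D + \<omega> * sin ?z - G1 y * cos ?z))"
    by (simp only: mult_1_left)
  \<comment> \<open>The Neumann sum contains the trigonometric terms with the opposite sign, so only
    D/\<rho> survives; multiplying by sqrt(r/p) then gives v' + (\<rho>'/\<rho>) v.\<close>
  have "1 / of_real (\<rho> y) * (G1 y * cos ?z - \<omega> * sin ?z) + 2 * (\<Sum>n. a n) = 1 / of_real (\<rho> y) * ?D"
    unfolding sums_unique[OF a, symmetric] by (simp add: algebra_simps add_divide_distrib diff_divide_distrib)
  then show ?thesis using sums_summable[OF a] by (simp only: rho_sqrt_cancel[OF y]) simp
qed

lemma representation_2:
  assumes v: "sl_solution A B p q r (\<omega>\<^sup>2) v" and \<omega>: "\<omega> \<noteq> 0"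
    and v_A: "v A = 0" and v'_A: "deriv_Icc A B v A = \<omega> / of_real (\<rho> A) * of_real (sqrt (r A / p A))"
    and y: "y \<in> {A..B}"
  defines "b \<equiv> \<lambda>n. (-1) ^ n * \<mu> (2 * n + 1) y * sph_bessel_j (2 * n + 1) (\<omega> * of_real (l y))"
  shows "summable b \<and> deriv_Icc A B v y =
      of_real (sqrt (r y / p y)) *
        (1 / of_real (\<rho> y) * (G2 y * sin (\<omega> * of_real (l y)) + \<omega> * cos (\<omega> * of_real (l y)))
          + 2 * (\<Sum>n. b n))
      - of_real (\<rho>' y / \<rho> y) * v y"
proof (cases "y = A")
  case True
  have l: "l A = 0" by (simp add: sl_l_def)
  \<comment> \<open>Every index is odd, hence positive, and the Bessel factor vanishes whatever the
    value of mu at A.\<close>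
  have "b n = 0" for n
    by (simp add: b_def True l sph_bessel_j_0_right)
  then have b: "b = (\<lambda>_. 0)" by (rule ext)
  show ?thesis unfolding b True l using v'_A v_A by simp
next
  case False
  then have y': "y \<in> {A<..B}" using y by simp
  let ?z = "\<omega> * of_real (l y)"
  let ?D = "of_real (\<rho> y * sqrt (p y / r y)) * (deriv_Icc A B v y + of_real (\<rho>' y / \<rho> y) * v y)"
  obtain C L where L: "L \<ge> 1" and d: "\<And>k. norm (moment y k) \<le> C * L ^ k"
    using norm_moment_le[OF y] by blast
  have "(\<lambda>n. (2 * of_nat (2 * n + 1) + 1) * ((-1) ^ n * sph_bessel_j (2 * n + 1) ?z * mu_bracket (moment y) (l y) (G2 y) (2 * n + 1)))
      sums (- \<i> * (\<i> * ?D) - \<omega> * cos ?z - G2 y * sin ?z)"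
    by (rule neumann_mu_bracket(2)[OF d L l_pos[OF y'] moment_series_2[OF v \<omega> v_A v'_A y]]) simp
  then have "(\<lambda>n. 1 / (2 * of_real (\<rho> y)) * ((2 * of_nat (2 * n + 1) + 1) * ((-1) ^ n * sph_bessel_j (2 * n + 1) ?z * mu_bracket (moment y) (l y) (G2 y) (2 * n + 1))))
      sums (1 / (2 * of_real (\<rho> y)) * (- \<i> * (\<i> * ?D) - \<omega> * cos ?z - G2 y * sin ?z))"
    by (rule sums_mult)
  moreover have "b = (\<lambda>n. 1 / (2 * of_real (\<rho> y)) * ((2 * of_nat (2 * n + 1) + 1) * ((-1) ^ n * sph_bessel_j (2 * n + 1) ?z * mu_bracket (moment y) (l y) (G2 y) (2 * n + 1))))"
    by (rule ext) (simp add: b_def mu_eq[OF y'])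
  \<comment> \<open>The factor i from the odd moment series meets the -i of the odd Neumann
    series.\<close>
  moreover have "- \<i> * (\<i> * ?D) = ?D" by (simp flip: mult.assoc)
  ultimately have b: "b sums (1 / (2 * of_real (\<rho> y)) * (?D - \<omega> * cos ?z - G2 y * sin ?z))"
    by (simp only:)
  have "1 / of_real (\<rho> y) * (G2 y * sin ?z + \<omega> * cos ?z) + 2 * (\<Sum>n. b n) = 1 / of_real (\<rho> y) * ?D"
    unfolding sums_unique[OF b, symmetric] by (simp add: algebra_simps add_divide_distrib diff_divide_distrib)
  then show ?thesis using sums_summable[OF b] by (simp only: rho_sqrt_cancel[OF y]) simp
qed

end

theorem mainTheorem2:
  fixes A B :: real
    and p r :: "real \<Rightarrow> real"
    and q g :: "real \<Rightarrow> complex"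
    and v1 v2 :: "complex \<Rightarrow> real \<Rightarrow> complex"
  assumes AB: "A < B"
    and q_cont: "continuous_on {A..B} q"
    and p_diff: "p differentiable_on {A..B}"
    and r_diff: "r differentiable_on {A..B}"
    and p_ac: "abs_continuous_Icc A B p"
    and p'_ac: "abs_continuous_Icc A B (deriv_Icc A B p)"
    and r_ac: "abs_continuous_Icc A B r"
    and r'_ac: "abs_continuous_Icc A B (deriv_Icc A B r)"
    and p_pos: "\<And>y. y \<in> {A..B} \<Longrightarrow> p y > 0"
    and r_pos: "\<And>y. y \<in> {A..B} \<Longrightarrow> r y > 0"
    and g_sol: "sl_solution A B p q r 0 g"
    and g_A: "g A = of_real (1 / sl_rho p r A)"
    and g_nz: "\<And>y. y \<in> {A..B} \<Longrightarrow> g y \<noteq> 0"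
    and v1_sol: "\<And>\<omega>. \<omega> \<noteq> 0 \<Longrightarrow> sl_solution A B p q r (\<omega>\<^sup>2) (v1 \<omega>)"
    and v1_A: "\<And>\<omega>. \<omega> \<noteq> 0 \<Longrightarrow> v1 \<omega> A = of_real (1 / sl_rho p r A)"
    and v1'_A: "\<And>\<omega>. \<omega> \<noteq> 0 \<Longrightarrow> deriv_Icc A B (v1 \<omega>) A = deriv_Icc A B g A"
    and v2_sol: "\<And>\<omega>. \<omega> \<noteq> 0 \<Longrightarrow> sl_solution A B p q r (\<omega>\<^sup>2) (v2 \<omega>)"
    and v2_A: "\<And>\<omega>. \<omega> \<noteq> 0 \<Longrightarrow> v2 \<omega> A = 0"
    and v2'_A: "\<And>\<omega>. \<omega> \<noteq> 0 \<Longrightarrow>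
      deriv_Icc A B (v2 \<omega>) A = \<omega> / of_real (sl_rho p r A) * of_real (sqrt (r A / p A))"
  shows "\<forall>\<omega> y. \<omega> \<noteq> 0 \<and> y \<in> {A..B} \<longrightarrow>
    (let \<rho> = sl_rho p r;
         \<rho>' = deriv_Icc A B \<rho>;
         l = sl_l A p r;
         G1 = sl_G1 A B p q r g;
         G2 = sl_G2 A B p q r g;
         \<mu> = sl_mu A B p q r g;
         a = (\<lambda>n. (-1) ^ n * \<mu> (2 * n) y * sph_bessel_j (2 * n) (\<omega> * of_real (l y)));
         b = (\<lambda>n. (-1) ^ n * \<mu> (2 * n + 1) y * sph_bessel_j (2 * n + 1) (\<omega> * of_real (l y)))
     in summable a \<and>
        deriv_Icc A B (v1 \<omega>) y =
          of_real (sqrt (r y / p y)) *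
            (1 / of_real (\<rho> y) *
               (G1 y * cos (\<omega> * of_real (l y)) - \<omega> * sin (\<omega> * of_real (l y)))
             + 2 * (\<Sum>n. a n))
          - of_real (\<rho>' y / \<rho> y) * v1 \<omega> y \<and>
        summable b \<and>
        deriv_Icc A B (v2 \<omega>) y =
          of_real (sqrt (r y / p y)) *
            (1 / of_real (\<rho> y) *
               (G2 y * sin (\<omega> * of_real (l y)) + \<omega> * cos (\<omega> * of_real (l y)))
             + 2 * (\<Sum>n. b n))
          - of_real (\<rho>' y / \<rho> y) * v2 \<omega> y)"
proof -
  interpret sl_problem A B p r q g
    using AB q_cont p_diff r_diff abs_continuous_Icc_imp_continuous_on[OF p'_ac]
      abs_continuous_Icc_imp_continuous_on[OF r'_ac] p_pos r_pos g_sol g_A g_nz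
    by unfold_locales
  show ?thesis
    unfolding Let_def
    using representation_1[OF v1_sol _ v1_A v1'_A] representation_2[OF v2_sol _ v2_A v2'_A]
    by blast
qed

end
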